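(* Let $\mathcal{I}\subset\mathbb{R}\setminus\{0\}$ be a finite nonempty set, let $N_i$, $i\in\mathcal{I}$, be independent homogeneous Poisson processes with rates $\lambda_i>0$, and let $M=\sum_{i\in\mathcal{I}}i\,N_i$ and $\lambda=\sum_{i\in\mathcal{I}}\lambda_i$. Then, for $t>0$ and $x>0$, $$P\Big\{\int_0^tM(s)\,ds\in dx\Big\}=e^{-\lambda t}\sum_{n\ge1}\frac{1}{n!}\sum_{\substack{(k_i)_{i\in\mathcal{I}}\in\mathbb{N}_0^{\mathcal{I}}\\ \sum_ik_i=n}}\binom{n}{(k_i)_{i\in\mathcal{I}}}\ \sum_{\substack{(h_i)_{i\in\mathcal{I}}\\0\le h_i\le k_i}}\ \prod_{i\in\mathcal{I}}\Big[\Big(\frac{\lambda_i}{i}\Big)^{k_i}\binom{k_i}{h_i}(-1)^{h_i}\Big]\,\mathbf{1}_{(t\sum_{j\in\mathcal{I}}jh_j,\infty)}(x)\,\frac{\big(x-t\sum_{j\in\mathcal{I}}jh_j\big)^{n-1}}{(n-1)!}\,dx.$$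
   Context: $\binom{n}{(k_i)_{i\in\mathcal{I}}}=n!/\prod_{i\in\mathcal{I}}k_i!$ is the multinomial coefficient, and $\mathbb{N}_0=\{0,1,2,\dots\}$. The identity gives the density on $(0,\infty)$ of the law of $\int_0^tM(s)\,ds$. *)

theory Defs
  imports "HOL-Probability.Probability"
begin

text \<open>
  Only \<open>0 \<le> s\<close> is meaningful as a time. The increments are differences of natural numbers;
  they are never truncated, since the paths are nondecreasing. Left limits of the paths exist
  automatically, and unit jumps (almost surely) follow from the Poisson increments.
\<close>

definition (in prob_space) poisson_process :: "real \<Rightarrow> (real \<Rightarrow> 'a \<Rightarrow> nat) \<Rightarrow> bool" where
  "poisson_process r N \<longleftrightarrow>
     0 < r \<and>
     (\<forall>s\<ge>0. random_variable (count_space UNIV) (N s)) \<and>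
     (\<forall>\<omega>\<in>space M. N 0 \<omega> = 0) \<and>
     (\<forall>\<omega>\<in>space M. mono_on {0..} (\<lambda>s. N s \<omega>)) \<and>
     (\<forall>\<omega>\<in>space M. \<forall>s\<ge>0. continuous (at_right s) (\<lambda>u. N u \<omega>)) \<and>
     (\<forall>(n::nat) \<tau> :: nat \<Rightarrow> real. 0 \<le> \<tau> 0 \<longrightarrow> (\<forall>k<n. \<tau> k < \<tau> (Suc k)) \<longrightarrow>
        indep_vars (\<lambda>_. count_space UNIV) (\<lambda>k \<omega>. N (\<tau> (Suc k)) \<omega> - N (\<tau> k) \<omega>) {..<n}) \<and>
     (\<forall>s u. 0 \<le> s \<longrightarrow> s < u \<longrightarrow>
        distr M (count_space UNIV) (\<lambda>\<omega>. N u \<omega> - N s \<omega>) = measure_pmf (poisson_pmf (r * (u - s))))"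

text \<open>
  Independence of processes: each process is regarded as a random element of the product space
  over the time set \<open>{0..}\<close>, so that the generated sigma-algebras are those of the whole paths.
\<close>

definition (in prob_space) indep_processes ::
    "('i \<Rightarrow> real \<Rightarrow> 'a \<Rightarrow> nat) \<Rightarrow> 'i set \<Rightarrow> bool" where
  "indep_processes N I \<longleftrightarrow>
     indep_vars (\<lambda>_. PiM {0..} (\<lambda>_. count_space UNIV)) (\<lambda>i \<omega>. \<lambda>s\<in>{0..}. N i s \<omega>) I"

definition weighted_sum_process ::
    "real set \<Rightarrow> (real \<Rightarrow> real \<Rightarrow> 'a \<Rightarrow> nat) \<Rightarrow> real \<Rightarrow> 'a \<Rightarrow> real" where
  "weighted_sum_process I N s \<omega> = (\<Sum>i\<in>I. i * real (N i s \<omega>))"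

definition multinomial_coeff :: "'i set \<Rightarrow> nat \<Rightarrow> ('i \<Rightarrow> nat) \<Rightarrow> real" where
  "multinomial_coeff I n k = fact n / (\<Prod>i\<in>I. fact (k i))"

text \<open>Families indexed by \<open>I\<close> are extensional functions, so that the index sets of the sums
  are finite.\<close>

definition density_term :: "real set \<Rightarrow> (real \<Rightarrow> real) \<Rightarrow> real \<Rightarrow> nat \<Rightarrow> real \<Rightarrow> real" where
  "density_term I rate t n x =
     1 / fact n *
     (\<Sum>k\<in>{k \<in> I \<rightarrow>\<^sub>E (UNIV :: nat set). (\<Sum>i\<in>I. k i) = n}.
        multinomial_coeff I n k *
        (\<Sum>h\<in>(\<Pi>\<^sub>E i\<in>I. {0..k i}).
           (\<Prod>i\<in>I. (rate i / i) ^ k i * real (k i choose h i) * (-1) ^ h i) *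
           indicator {t * (\<Sum>j\<in>I. j * real (h j))<..} x *
           ((x - t * (\<Sum>j\<in>I. j * real (h j))) ^ (n - 1) / fact (n - 1))))"

definition integral_density :: "real set \<Rightarrow> (real \<Rightarrow> real) \<Rightarrow> real \<Rightarrow> real \<Rightarrow> real" where
  "integral_density I rate t x =
     exp (- (\<Sum>i\<in>I. rate i) * t) * (\<Sum>n. density_term I rate t (Suc n) x)"

end

theory Submission
  imports Defs
begin

text \<open>
  The argument compares two-sided Laplace transforms at \<open>z = 1 + \<i> u\<close>. On the probabilistic side,
  Riemann sums of \<open>M\<close> are linear combinations of independent Poisson increments; in the limit
  \<open>E exp (- z Y) = exp (- \<lambda> t) exp \<Phi>\<close> with \<open>\<Phi> = (\<Sum>i\<in>I. \<lambda>\<^sub>i / i * (1 - exp (- z t i)) / z)\<close>.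
  On the other side, the transform of \<open>(x - a)\<^sub>+\<close> to the power \<open>n - 1\<close>, divided by \<open>(n - 1)!\<close>, is
  \<open>exp (- z a)\<close> divided by the \<open>n\<close>-th power of \<open>z\<close>, so by the multinomial and binomial theorems the
  \<open>n\<close>-th density term has transform \<open>\<Phi>\<close> to the power \<open>n\<close> divided by \<open>n!\<close>. Summing over \<open>n \<ge> 1\<close> gives
  \<open>exp (- \<lambda> t) (exp \<Phi> - 1)\<close>; the missing \<open>exp (- \<lambda> t)\<close> is the atom at \<open>0\<close>. The factor \<open>exp (- x)\<close>, coming
  from \<open>Re z = 1\<close>, makes the powers integrable at infinity, and uniqueness of Fourier transforms
  of finite measures concludes.
\<close>

section \<open>Multinomial expansions\<close>

lemma finite_compositions:
  assumes "finite I"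
  shows "finite {k \<in> I \<rightarrow>\<^sub>E (UNIV :: nat set). (\<Sum>i\<in>I. k i) = n}"
proof (rule finite_subset)
  show "{k \<in> I \<rightarrow>\<^sub>E (UNIV :: nat set). (\<Sum>i\<in>I. k i) = n} \<subseteq> I \<rightarrow>\<^sub>E {0..n}"
    using assms by (auto simp: PiE_iff extensional_def intro: member_le_sum)
  show "finite (I \<rightarrow>\<^sub>E {0..n})"
    using assms by (intro finite_PiE) auto
qed

text \<open>Induction on \<open>I\<close>. Splitting off the value \<open>m\<close> at the new index
  \<open>a\<close> leaves a family of total \<open>n - m\<close>, and the coefficient factors as
  \<open>n choose m\<close> times the multinomial coefficient of the rest; summing over
  \<open>m\<close> is then the binomial theorem.\<close>

lemma multinomial_theorem:
  fixes x :: "'i \<Rightarrow> 'b::real_normed_field"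
  assumes "finite I"
  shows "(\<Sum>i\<in>I. x i) ^ n =
    (\<Sum>k\<in>{k \<in> I \<rightarrow>\<^sub>E (UNIV :: nat set). (\<Sum>i\<in>I. k i) = n}.
       of_real (multinomial_coeff I n k) * (\<Prod>i\<in>I. x i ^ k i))"
  using assms
proof (induction I arbitrary: n rule: finite_induct)
  case empty
  show ?case by (cases n) (auto simp: multinomial_coeff_def)
next
  case (insert a I)
  let ?C = "\<lambda>I n. {k \<in> I \<rightarrow>\<^sub>E (UNIV :: nat set). (\<Sum>i\<in>I. k i) = n}"
  let ?T = "\<lambda>I n k. of_real (multinomial_coeff I n k) * (\<Prod>i\<in>I. x i ^ k i)"
  have upd: "(\<Sum>i\<in>I. (k(a := m)) i) = (\<Sum>i\<in>I. k i)" for k :: "'i \<Rightarrow> nat" and m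
    using insert.hyps by (intro sum.cong) auto
  \<comment> \<open>A family on \<open>insert a I\<close> corresponds to its value at
    \<open>a\<close> together with its restriction to \<open>I\<close>; resetting \<open>a\<close>
    to \<open>undefined\<close> is what extensionality on \<open>I\<close> demands.\<close>
  have "(\<Sum>k\<in>?C (insert a I) n. ?T (insert a I) n k) =
      (\<Sum>(m, k)\<in>(SIGMA m:{..n}. ?C I (n - m)). ?T (insert a I) n (k(a := m)))"
  proof (rule sum.reindex_bij_witness
      [where i = "\<lambda>(m, k). k(a := m)" and j = "\<lambda>k. (k a, k(a := undefined))"])
    fix k assume k: "k \<in> ?C (insert a I) n"
    then show "(case (k a, k(a := undefined)) of (m, k) \<Rightarrow> k(a := m)) = k" by simp
    show "(k a, k(a := undefined)) \<in> (SIGMA m:{..n}. ?C I (n - m))"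
    proof -
      have "(\<Sum>i\<in>I. (k(a := undefined)) i) = (\<Sum>i\<in>I. k i)"
        using insert.hyps by (intro sum.cong) auto
      then show ?thesis using k insert.hyps by (auto simp: PiE_iff extensional_def)
    qed
  next
    fix p assume p: "p \<in> (SIGMA m:{..n}. ?C I (n - m))"
    obtain m k where mk: "p = (m, k)" by force
    show "(\<lambda>k. (k a, k(a := undefined))) (case p of (m, k) \<Rightarrow> k(a := m)) = p"
      using p insert.hyps by (auto simp: mk PiE_iff extensional_def)
    show "(case p of (m, k) \<Rightarrow> k(a := m)) \<in> ?C (insert a I) n"
      using p insert.hyps upd[of k m] unfolding mk
      by (auto simp: PiE_iff extensional_def simp del: fun_upd_apply) (auto split: if_splits)
  qed (simp del: fun_upd_apply)
  also have "\<dots> = (\<Sum>m\<le>n. \<Sum>k\<in>?C I (n - m). ?T (insert a I) n (k(a := m)))"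
    using insert.hyps by (intro sum.Sigma[symmetric]) (auto intro: finite_compositions)
  also have "\<dots> = (\<Sum>m\<le>n. of_nat (n choose m) * x a ^ m * (\<Sum>k\<in>?C I (n - m). ?T I (n - m) k))"
  proof (intro sum.cong refl, unfold sum_distrib_left, intro sum.cong refl)
    fix m k assume m: "m \<in> {..n}" and k: "k \<in> ?C I (n - m)"
    have "(\<Prod>i\<in>I. fact ((k(a := m)) i)) = (\<Prod>i\<in>I. fact (k i) :: real)"
      "(\<Prod>i\<in>I. x i ^ ((k(a := m)) i)) = (\<Prod>i\<in>I. x i ^ k i)"
      using insert.hyps by (auto intro!: prod.cong)
    moreover have "real (n choose m) = fact n / (fact m * fact (n - m))"
      using m by (simp add: binomial_fact)
    moreover have "of_nat (n choose m) = (of_real (real (n choose m)) :: 'b)"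
      by simp
    ultimately show "?T (insert a I) n (k(a := m)) =
        of_nat (n choose m) * x a ^ m * ?T I (n - m) k"
      using insert.hyps by (simp add: multinomial_coeff_def del: of_real_of_nat_eq)
  qed
  also have "\<dots> = (\<Sum>i\<in>insert a I. x i) ^ n"
    using insert by (simp add: binomial_ring)
  finally show ?case ..
qed

text \<open>A sum over \<open>PiE\<close> of products is a product of sums, so the inner sum splits
  into one binomial expansion per index. The multinomial theorem then collects the resulting powers
  of \<open>c i * (1 + y i)\<close>.\<close>

lemma multinomial_binomial_expansion:
  fixes c y :: "'i \<Rightarrow> 'b::real_normed_field"
  assumes "finite I"
  shows "(\<Sum>k\<in>{k \<in> I \<rightarrow>\<^sub>E (UNIV :: nat set). (\<Sum>i\<in>I. k i) = n}.
       of_real (multinomial_coeff I n k) *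
       (\<Sum>h\<in>(\<Pi>\<^sub>E i\<in>I. {0..k i}). \<Prod>i\<in>I. c i ^ k i * of_nat (k i choose h i) * y i ^ h i)) =
     (\<Sum>i\<in>I. c i * (1 + y i)) ^ n"
proof -
  have "(\<Sum>h\<in>(\<Pi>\<^sub>E i\<in>I. {0..k i}). \<Prod>i\<in>I. c i ^ k i * of_nat (k i choose h i) * y i ^ h i) =
      (\<Prod>i\<in>I. (c i * (1 + y i)) ^ k i)" for k :: "'i \<Rightarrow> nat"
  proof -
    have "(\<Prod>i\<in>I. \<Sum>h\<in>{0..k i}. c i ^ k i * of_nat (k i choose h) * y i ^ h) =
        (\<Prod>i\<in>I. (c i * (1 + y i)) ^ k i)"
    proof (rule prod.cong)
      fix i
      have "(y i + 1) ^ k i = (\<Sum>h\<le>k i. of_nat (k i choose h) * y i ^ h)"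
        by (simp add: binomial_ring)
      then show "(\<Sum>h\<in>{0..k i}. c i ^ k i * of_nat (k i choose h) * y i ^ h) =
          (c i * (1 + y i)) ^ k i"
        by (simp add: power_mult_distrib atMost_atLeast0 add.commute sum_distrib_left mult.assoc)
    qed simp
    then show ?thesis
      using assms by (subst prod_sum_PiE[symmetric]) auto
  qed
  then show ?thesis using multinomial_theorem[OF assms, of "\<lambda>i. c i * (1 + y i)" n] by simp
qed

section \<open>Laplace transform of the density\<close>

text \<open>Supplies the boundary value at infinity for the integration by parts in
  \<open>laplace_power\<close>.\<close>

lemma laplace_tendsto_0:
  assumes "0 < Re z"
  shows "((\<lambda>x. exp (- z * of_real x) * of_real (x ^ n / fact n)) \<longlongrightarrow> 0) at_top"
proof (rule tendsto_norm_zero_cancel)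
  have "((\<lambda>x. exp (- (Re z * x)) * x ^ n / fact n) \<longlongrightarrow> 0) at_top"
  proof -
    have "filterlim (\<lambda>x. Re z * x) at_top at_top"
      using assms by real_asymp
    from filterlim_compose[OF tendsto_power_div_exp_0[of n] this]
    have "((\<lambda>x. (1 / (Re z ^ n * fact n)) * ((Re z * x) ^ n / exp (Re z * x))) \<longlongrightarrow>
        (1 / (Re z ^ n * fact n)) * 0) at_top"
      by (intro tendsto_mult tendsto_const)
    then show ?thesis using assms by (simp add: power_mult_distrib exp_minus field_simps)
  qed
  then show "((\<lambda>x. norm (exp (- z * of_real x) * of_real (x ^ n / fact n))) \<longlongrightarrow> 0) at_top"
  proof (rule Lim_transform_eventually)
    show "\<forall>\<^sub>F x in at_top. exp (- (Re z * x)) * x ^ n / fact n =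
        norm (exp (- z * of_real x) * of_real (x ^ n / fact n))"
      using eventually_ge_at_top[of 0]
      by eventually_elim (simp add: norm_mult norm_divide norm_power del: of_real_divide of_real_power)
  qed
qed

text \<open>The modulus of the integrand is bounded by a multiple of the Erlang density of rate
  \<open>Re z\<close>, which integrates to 1.\<close>

lemma laplace_power_integrable:
  assumes "0 < Re z"
  shows "integrable lborel
    (\<lambda>x. exp (- z * of_real x) * of_real (indicator {0<..} x * (x ^ n / fact n)))"
proof (rule Bochner_Integration.integrable_bound)
  let ?l = "Re z"
  interpret prob_space "density lborel (erlang_density n ?l)"
    using assms by (rule prob_space_erlang_density)
  have "integrable lborel (erlang_density n ?l)"
    using assms integrable_const[of "1::real"]
    by (subst (asm) integrable_density) auto
  then show "integrable lborel (\<lambda>x. erlang_density n ?l x / ?l ^ Suc n)" by simp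
  show "AE x in lborel. norm (exp (- z * of_real x) *
      of_real (indicator {0<..} x * (x ^ n / fact n))) \<le> norm (erlang_density n ?l x / ?l ^ Suc n)"
    using assms by (auto simp: erlang_density_def norm_mult norm_power norm_divide mult.commute
        split: split_indicator)
qed simp

text \<open>Induction by integration by parts. With \<open>G n\<close> the untruncated integrand,
  the derivative of \<open>G (Suc n)\<close> is \<open>G n - z * G (Suc n)\<close>, and
  \<open>G (Suc n)\<close> vanishes at both ends of the half-line, so each step divides by
  \<open>z\<close>. The start uses \<open>G 0 0 = 1\<close>.\<close>

lemma laplace_power:
  assumes "0 < Re z"
  shows "(LINT x|lborel. exp (- z * of_real x) *
    of_real (indicator {0<..} x * (x ^ n / fact n))) = 1 / z ^ Suc n"
proof -
  define J where "J = (\<lambda>n. LINT x|lborel. exp (- z * of_real x) *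
    of_real (indicator {0<..} x * (x ^ n / fact n)))"
  have z: "z \<noteq> 0" using assms by auto
  have J: "(LBINT x=0..\<infinity>. exp (- z * of_real x) * of_real (x ^ n / fact n)) = J n" for n
    unfolding J_def interval_lebesgue_integral_def set_lebesgue_integral_def
    unfolding zero_ereal_def
    by (subst if_P, simp, intro Bochner_Integration.integral_cong) (auto split: split_indicator)
  have si: "set_integrable lborel (einterval 0 \<infinity>)
      (\<lambda>x. exp (- z * of_real x) * of_real (x ^ n / fact n))" for n
    unfolding set_integrable_def zero_ereal_def
    by (rule Bochner_Integration.integrable_cong
          [THEN iffD1, OF refl _ laplace_power_integrable[OF assms, of n]])
      (auto split: split_indicator)
  define G where "G = (\<lambda>n x. exp (- z * of_real x) * of_real (x ^ n / fact n))"
  have top: "((G n \<circ> real_of_ereal) \<longlongrightarrow> 0) (at_left \<infinity>)" for n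
    unfolding G_def ereal_tendsto_simps1(3) by (rule laplace_tendsto_0[OF assms])
  have bot: "((G n \<circ> real_of_ereal) \<longlongrightarrow> G n 0) (at_right 0)" for n
    unfolding zero_ereal_def G_def by (rule ereal_tendsto_simps1(2)[THEN iffD2])
      (auto intro!: tendsto_eq_intros)
  \<comment> \<open>The integrand is an entire function restricted to the real axis, so complex
    differentiation rules yield its vector derivative.\<close>
  have G: "G n = (\<lambda>x. (\<lambda>w. exp (- z * w) * (w ^ n / fact n)) (of_real x))" for n
    unfolding G_def by auto
  have cont: "isCont (G n) x" for n x
    unfolding G_def by simp
  have "(LBINT x=0..\<infinity>. - z * G 0 x) = 0 - G 0 0"
  proof (rule interval_integral_FTC_integrable)
    show "(G 0 has_vector_derivative - z * G 0 x) (at x)" for x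
      unfolding G by (rule has_vector_derivative_real_field) (auto intro!: derivative_eq_intros)
    show "isCont (\<lambda>x. - z * G 0 x) x" for x by (intro continuous_intros cont)
    show "set_integrable lborel (einterval 0 \<infinity>) (\<lambda>x. - z * G 0 x)"
      unfolding G_def using si[of 0] by (intro set_integrable_mult_right) simp
  qed (use top bot in auto)
  moreover have "(LBINT x=0..\<infinity>. - z * G 0 x) = - z * J 0"
    unfolding J[symmetric] G_def by (rule interval_lebesgue_integral_mult_right)
  ultimately have 0: "J 0 = 1 / z"
    using z by (simp add: G_def field_simps)
  have "J (Suc n) = J n / z" for n
  proof -
    have "(LBINT x=0..\<infinity>. G n x - z * G (Suc n) x) = 0 - G (Suc n) 0"
    proof (rule interval_integral_FTC_integrable)
      show "(G (Suc n) has_vector_derivative G n x - z * G (Suc n) x) (at x)" for x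
      proof -
        have "((\<lambda>w. w ^ Suc n / fact (Suc n)) has_field_derivative w ^ n / fact n) (at w)"
          for w :: complex
          by (rule derivative_eq_intros refl | simp del: of_nat_Suc)+
        then have "((\<lambda>w. exp (- z * w) * (w ^ Suc n / fact (Suc n))) has_field_derivative
            - z * exp (- z * w) * (w ^ Suc n / fact (Suc n)) + w ^ n / fact n * exp (- z * w)) (at w)"
          for w by (rule DERIV_mult[rotated]) (auto intro!: derivative_eq_intros)
        from this[of "of_real x"] show ?thesis unfolding G
          by (intro has_vector_derivative_real_field)
            (simp only: mult_ac diff_conv_add_uminus add.commute mult_minus_left mult_minus_right)
      qed
      show "isCont (\<lambda>x. G n x - z * G (Suc n) x) x" for x
        by (intro continuous_intros cont)
      show "set_integrable lborel (einterval 0 \<infinity>) (\<lambda>x. G n x - z * G (Suc n) x)"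
        unfolding G_def using si[of n] si[of "Suc n"]
        by (intro set_integral_diff(1) set_integrable_mult_right) simp_all
    qed (use top bot in auto)
    moreover have "(LBINT x=0..\<infinity>. G n x - z * G (Suc n) x) = J n - z * J (Suc n)"
      unfolding J[symmetric] G_def using si[of n] si[of "Suc n"]
      by (subst interval_lebesgue_integral_diff(2))
        (auto simp: interval_lebesgue_integrable_def zero_ereal_def)
    ultimately show ?thesis using z by (simp add: G_def field_simps)
  qed
  then have "J n = 1 / z ^ Suc n" by (induction n) (use 0 in auto)
  then show ?thesis unfolding J_def .
qed

text \<open>Translation by \<open>a\<close>, of either sign, reduces to the unshifted power and
  pulls out the factor \<open>exp (- z * a)\<close>.\<close>

lemma laplace_shifted_power:
  assumes "0 < Re z"
  shows "has_bochner_integral lborel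
    (\<lambda>x. exp (- z * of_real x) * of_real (indicator {a<..} x * ((x - a) ^ n / fact n)))
    (exp (- z * of_real a) / z ^ Suc n)"
proof -
  let ?f = "\<lambda>x. exp (- z * of_real x) * of_real (indicator {0<..} x * (x ^ n / fact n))"
  have "has_bochner_integral lborel ?f (1 / z ^ Suc n)"
    using laplace_power[OF assms] laplace_power_integrable[OF assms]
    by (simp add: has_bochner_integral_iff)
  then have "has_bochner_integral lborel (\<lambda>x. ?f (- a + 1 * x)) (1 / z ^ Suc n)"
    by (subst (asm) lborel_has_bochner_integral_real_affine_iff[of 1 _ _ "- a"]) auto
  then have "has_bochner_integral lborel (\<lambda>x. exp (- z * of_real a) * ?f (- a + 1 * x))
      (exp (- z * of_real a) * (1 / z ^ Suc n))"
    by (rule has_bochner_integral_mult_right)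
  also have "(\<lambda>x. exp (- z * of_real a) * ?f (- a + 1 * x)) =
      (\<lambda>x. exp (- z * of_real x) * of_real (indicator {a<..} x * ((x - a) ^ n / fact n)))"
  proof
    fix x
    have "exp (- z * of_real a) * exp (- z * of_real (- a + 1 * x)) = exp (- z * of_real x)"
      by (subst exp_add[symmetric]) (simp add: algebra_simps)
    moreover have "indicator {0<..} (- a + 1 * x) = (indicator {a<..} x :: real)" "- a + 1 * x = x - a"
      by (auto split: split_indicator)
    ultimately show "exp (- z * of_real a) * ?f (- a + 1 * x) =
        exp (- z * of_real x) * of_real (indicator {a<..} x * ((x - a) ^ n / fact n))"
      by (simp only: mult.assoc[symmetric])
  qed
  finally show ?thesis by simp
qed

section \<open>Weighted sums of shifted powers: transform and majorants\<close>

text \<open>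
  The density terms are the case \<open>s = - 1\<close>; with \<open>s = 1\<close> and \<open>\<bar>c i\<bar>\<close> in place of \<open>c i\<close> the same
  sum is a majorant whose Laplace transform is again known in closed form.
\<close>

definition shifted_power_sum ::
    "real set \<Rightarrow> real \<Rightarrow> (real \<Rightarrow> real) \<Rightarrow> real \<Rightarrow> nat \<Rightarrow> real \<Rightarrow> real" where
  "shifted_power_sum I t c s n x =
     1 / fact n *
     (\<Sum>k\<in>{k \<in> I \<rightarrow>\<^sub>E (UNIV :: nat set). (\<Sum>i\<in>I. k i) = n}.
        multinomial_coeff I n k *
        (\<Sum>h\<in>(\<Pi>\<^sub>E i\<in>I. {0..k i}).
           (\<Prod>i\<in>I. c i ^ k i * real (k i choose h i) * s ^ h i) *
           (indicator {t * (\<Sum>j\<in>I. j * real (h j))<..} x *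
           ((x - t * (\<Sum>j\<in>I. j * real (h j))) ^ (n - 1) / fact (n - 1)))))"

lemma density_term_eq_shifted_power_sum:
  "density_term I rate t n x = shifted_power_sum I t (\<lambda>i. rate i / i) (- 1) n x"
  by (simp add: density_term_def shifted_power_sum_def mult.assoc)

text \<open>The exponential of the total shift is a product over \<open>I\<close> of
  \<open>h i\<close>-th powers, so it merges with the factors \<open>s ^ h i\<close> and the
  binomial expansion applies. The general field covers the complex \<open>w = - z\<close> of the
  transform and the real \<open>w = - 1\<close> of the pointwise bound.\<close>

lemma exp_shift_expansion:
  fixes w :: "'b::{real_normed_field, banach}"
  assumes "finite I"
  shows "(\<Sum>k\<in>{k \<in> I \<rightarrow>\<^sub>E (UNIV :: nat set). (\<Sum>i\<in>I. k i) = n}.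
        of_real (multinomial_coeff I n k) *
        (\<Sum>h\<in>(\<Pi>\<^sub>E i\<in>I. {0..k i}).
           of_real (\<Prod>i\<in>I. c i ^ k i * real (k i choose h i) * s ^ h i) *
           exp (w * of_real (t * (\<Sum>j\<in>I. j * real (h j)))))) =
    (\<Sum>i\<in>I. of_real (c i) * (1 + of_real s * exp (w * of_real (t * i)))) ^ n"
proof -
  have "of_real (\<Prod>i\<in>I. c i ^ k i * real (k i choose h i) * s ^ h i) *
      exp (w * of_real (t * (\<Sum>j\<in>I. j * real (h j)))) =
      (\<Prod>i\<in>I. of_real (c i) ^ k i * of_nat (k i choose h i) *
        (of_real s * exp (w * of_real (t * i))) ^ h i)" for k h :: "real \<Rightarrow> nat"
  proof -
    have "exp (w * of_real (t * (\<Sum>j\<in>I. j * real (h j)))) =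
        (\<Prod>i\<in>I. exp (w * of_real (t * i)) ^ h i)"
      by (simp add: sum_distrib_left exp_sum[OF assms] algebra_simps flip: exp_of_nat_mult)
    then show ?thesis
      by (simp add: power_mult_distrib prod.distrib algebra_simps)
  qed
  then show ?thesis
    using multinomial_binomial_expansion[OF assms, where c = "\<lambda>i. of_real (c i)"
        and y = "\<lambda>i. of_real s * exp (w * of_real (t * i))" and n = n] by simp
qed

text \<open>All summands carry the same power of \<open>1 / z\<close>, so after termwise integration
  it moves into the base of the \<open>Suc n\<close>-th power. Working at \<open>Suc n\<close> keeps
  the exponent \<open>n - 1\<close> of the definition from being truncated.\<close>

lemma laplace_shifted_power_sum:
  assumes "finite I" "0 < Re z"
  shows "has_bochner_integral lborel
    (\<lambda>x. exp (- z * of_real x) * of_real (shifted_power_sum I t c s (Suc n) x))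
    ((\<Sum>i\<in>I. of_real (c i) * (1 + of_real s * exp (- z * of_real (t * i))) / z) ^ Suc n
      / fact (Suc n))"
proof -
  let ?K = "{k \<in> I \<rightarrow>\<^sub>E (UNIV :: nat set). (\<Sum>i\<in>I. k i) = Suc n}"
  let ?H = "\<lambda>k. (\<Pi>\<^sub>E i\<in>I. {0..k i})"
  let ?a = "\<lambda>h. t * (\<Sum>j\<in>I. j * real (h j))"
  let ?w = "\<lambda>k h. \<Prod>i\<in>I. c i ^ k i * real (k i choose h i) * s ^ h i"
  let ?e = "\<lambda>h x. exp (- z * of_real x) *
    of_real (indicator {?a h<..} x * ((x - ?a h) ^ n / fact n))"
  have "has_bochner_integral lborel
      (\<lambda>x. 1 / fact (Suc n) * (\<Sum>k\<in>?K. of_real (multinomial_coeff I (Suc n) k) *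
        (\<Sum>h\<in>?H k. of_real (?w k h) * ?e h x)))
      (1 / fact (Suc n) * (\<Sum>k\<in>?K. of_real (multinomial_coeff I (Suc n) k) *
        (\<Sum>h\<in>?H k. of_real (?w k h) * (exp (- z * of_real (?a h)) / z ^ Suc n))))"
    by (intro has_bochner_integral_mult_right has_bochner_integral_sum
        laplace_shifted_power[OF assms(2)])
  also have "(\<lambda>x. 1 / fact (Suc n) * (\<Sum>k\<in>?K. of_real (multinomial_coeff I (Suc n) k) *
        (\<Sum>h\<in>?H k. of_real (?w k h) * ?e h x))) =
      (\<lambda>x. exp (- z * of_real x) * of_real (shifted_power_sum I t c s (Suc n) x))"
    unfolding shifted_power_sum_def
    by (simp only: of_real_mult of_real_sum of_real_divide of_real_1 of_real_fact
        sum_distrib_left diff_Suc_1 mult_ac)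
  also have "1 / fact (Suc n) * (\<Sum>k\<in>?K. of_real (multinomial_coeff I (Suc n) k) *
        (\<Sum>h\<in>?H k. of_real (?w k h) * (exp (- z * of_real (?a h)) / z ^ Suc n))) =
      (\<Sum>k\<in>?K. of_real (multinomial_coeff I (Suc n) k) *
        (\<Sum>h\<in>?H k. of_real (?w k h) * exp (- z * of_real (?a h)))) / z ^ Suc n / fact (Suc n)"
    by (simp only: times_divide_eq_right sum_divide_distrib[symmetric] mult_1 times_divide_eq_left
        divide_divide_eq_left mult.commute[of "z ^ Suc n"])
  also have "\<dots> = (\<Sum>i\<in>I. of_real (c i) * (1 + of_real s * exp (- z * of_real (t * i))) / z)
      ^ Suc n / fact (Suc n)"
    by (simp only: exp_shift_expansion[OF assms(1)] power_divide sum_divide_distrib[symmetric])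
  finally show ?thesis .
qed

lemma prod_binomial_weight_nonneg:
  assumes "\<And>i. i \<in> I \<Longrightarrow> 0 \<le> c i"
  shows "0 \<le> multinomial_coeff I n k" "0 \<le> (\<Prod>i\<in>I. c i ^ k i * real (k i choose h i) * 1 ^ h i)"
  using assms by (auto simp: multinomial_coeff_def intro!: prod_nonneg divide_nonneg_nonneg)

text \<open>Triangle inequality: the sign factors have modulus 1, and the truncated powers are
  nonnegative because the indicator forces \<open>x - a\<close> to be positive.\<close>

lemma abs_shifted_power_sum_le:
  assumes "\<bar>s\<bar> = 1"
  shows "\<bar>shifted_power_sum I t c s n x\<bar> \<le> shifted_power_sum I t (\<lambda>i. \<bar>c i\<bar>) 1 n x"
proof -
  have p: "\<bar>\<Prod>i\<in>I. c i ^ k i * real (k i choose h i) * s ^ h i\<bar> =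
      (\<Prod>i\<in>I. \<bar>c i\<bar> ^ k i * real (k i choose h i) * 1 ^ h i)" for k h :: "real \<Rightarrow> nat"
    using assms by (simp add: abs_prod abs_mult power_abs)
  \<comment> \<open>The zero family only serves to meet the hypothesis of the lemma; the multinomial
    coefficient does not involve it.\<close>
  have m: "\<bar>multinomial_coeff I n k\<bar> = multinomial_coeff I n k" for k :: "real \<Rightarrow> nat"
    using prod_binomial_weight_nonneg(1)[of I "\<lambda>_. 0"] by simp
  have e: "\<bar>indicator {a<..} x * ((x - a) ^ (n - 1) / fact (n - 1))\<bar> =
      indicator {a<..} x * ((x - a) ^ (n - 1) / fact (n - 1))" for a :: real
    by (simp split: split_indicator)
  have "\<bar>multinomial_coeff I n k * (\<Sum>h\<in>(\<Pi>\<^sub>E i\<in>I. {0..k i}).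
        (\<Prod>i\<in>I. c i ^ k i * real (k i choose h i) * s ^ h i) *
        (indicator {a h<..} x * ((x - a h) ^ (n - 1) / fact (n - 1))))\<bar> \<le>
      multinomial_coeff I n k * (\<Sum>h\<in>(\<Pi>\<^sub>E i\<in>I. {0..k i}).
        (\<Prod>i\<in>I. \<bar>c i\<bar> ^ k i * real (k i choose h i) * 1 ^ h i) *
        (indicator {a h<..} x * ((x - a h) ^ (n - 1) / fact (n - 1))))" for k and a :: "_ \<Rightarrow> real"
    unfolding abs_mult[of "multinomial_coeff I n k"] m
  proof (intro mult_left_mono order_trans[OF sum_abs] sum_mono)
    show "0 \<le> multinomial_coeff I n k" using m[of k] by simp
  qed (simp only: abs_mult[of "prod _ _"] p e)
  then show ?thesis
    unfolding shifted_power_sum_def abs_mult[of "1 / _"]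
    by (intro mult_mono order_trans[OF sum_abs] sum_mono) auto
qed

text \<open>A single term of the exponential series bounds each truncated power by
  \<open>exp (x - a)\<close>, and the factors \<open>exp (- a)\<close> recombine in closed form. For
  fixed \<open>x\<close> this is the \<open>n\<close>-th term of a convergent exponential
  series.\<close>

lemma shifted_power_sum_le_exp:
  assumes "finite I" "\<And>i. i \<in> I \<Longrightarrow> 0 \<le> c i"
  shows "shifted_power_sum I t c 1 n x \<le>
    exp x * ((\<Sum>i\<in>I. c i * (1 + exp (- t * i))) ^ n / fact n)"
proof -
  let ?K = "{k \<in> I \<rightarrow>\<^sub>E (UNIV :: nat set). (\<Sum>i\<in>I. k i) = n}"
  have e: "indicator {a<..} x * ((x - a) ^ (n - 1) / fact (n - 1)) \<le> exp x * exp (- 1 * a)"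
    for a :: real
  proof (cases "a < x")
    case True
    have "(\<Sum>m\<in>{n - 1}. (x - a) ^ m /\<^sub>R fact m) \<le> (\<Sum>m. (x - a) ^ m /\<^sub>R fact m)"
      using True by (intro sum_le_suminf summable_exp_generic) auto
    then have "(x - a) ^ (n - 1) / fact (n - 1) \<le> exp (x - a)"
      by (simp add: exp_def divide_inverse mult.commute)
    then show ?thesis using True by (simp add: exp_diff exp_minus divide_inverse)
  qed simp
  have "shifted_power_sum I t c 1 n x \<le> 1 / fact n *
     (\<Sum>k\<in>?K. multinomial_coeff I n k * (\<Sum>h\<in>(\<Pi>\<^sub>E i\<in>I. {0..k i}).
        (\<Prod>i\<in>I. c i ^ k i * real (k i choose h i) * 1 ^ h i) *
        (exp x * exp (- 1 * (t * (\<Sum>j\<in>I. j * real (h j)))))))"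
    unfolding shifted_power_sum_def
    by (intro mult_left_mono sum_mono e prod_binomial_weight_nonneg assms) auto
  also have "\<dots> = exp x / fact n *
     (\<Sum>k\<in>?K. of_real (multinomial_coeff I n k) * (\<Sum>h\<in>(\<Pi>\<^sub>E i\<in>I. {0..k i}).
        of_real (\<Prod>i\<in>I. c i ^ k i * real (k i choose h i) * 1 ^ h i) *
        exp (- 1 * of_real (t * (\<Sum>j\<in>I. j * real (h j))))))"
    by (simp add: sum_distrib_left mult_ac)
  also have "\<dots> = exp x * ((\<Sum>i\<in>I. c i * (1 + exp (- t * i))) ^ n / fact n)"
    unfolding exp_shift_expansion[OF assms(1), of n c 1 "- 1" t] by simp
  finally show ?thesis .
qed

section \<open>Summation over the number of jumps\<close>

lemma measurable_density_term [measurable]: "density_term I rate t n \<in> borel_measurable borel"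
  unfolding density_term_def by measurable

lemma measurable_integral_density [measurable]:
  "integral_density I rate t \<in> borel_measurable borel"
  unfolding integral_density_def by measurable

lemma summable_Suc_exp: "summable (\<lambda>n. (a::real) ^ Suc n / fact (Suc n))"
  using summable_exp_generic[of a] by (subst summable_Suc_iff) (simp add: field_simps)

lemma abs_density_term_le:
  "\<bar>density_term I rate t n x\<bar> \<le> shifted_power_sum I t (\<lambda>i. \<bar>rate i / i\<bar>) 1 n x"
  unfolding density_term_eq_shifted_power_sum by (rule abs_shifted_power_sum_le) simp

lemma summable_density_term:
  assumes "finite I"
  shows "summable (\<lambda>n. norm (density_term I rate t (Suc n) x))"
proof (rule summable_comparison_test')
  let ?C = "\<Sum>i\<in>I. \<bar>rate i / i\<bar> * (1 + exp (- t * i))"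
  show "summable (\<lambda>n. exp x * (?C ^ Suc n / fact (Suc n)))"
    by (intro summable_mult summable_Suc_exp)
  show "norm (norm (density_term I rate t (Suc n) x)) \<le> exp x * (?C ^ Suc n / fact (Suc n))" for n
  proof -
    have "\<bar>density_term I rate t (Suc n) x\<bar> \<le> exp x * (?C ^ Suc n / fact (Suc n))"
      by (rule order_trans[OF abs_density_term_le shifted_power_sum_le_exp[OF assms]]) simp
    then show ?thesis by (simp only: real_norm_def abs_idempotent)
  qed
qed

text \<open>Bounds the L1 norms by a sequence summable in \<open>n\<close>, as the exchange of sum
  and integral requires. The modulus of \<open>exp (- z * x)\<close> depends only on
  \<open>Re z\<close>, so the transform of the majorant at the real point \<open>Re z\<close> is the
  bound.\<close>

lemma laplace_density_term_norm:
  assumes "finite I" "0 < Re z"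
  shows "(LINT x|lborel. norm (exp (- z * of_real x) * of_real (density_term I rate t (Suc n) x))) \<le>
    (\<Sum>i\<in>I. \<bar>rate i / i\<bar> * (1 + exp (- Re z * (t * i))) / Re z) ^ Suc n / fact (Suc n)"
proof -
  let ?S = "shifted_power_sum I t (\<lambda>i. \<bar>rate i / i\<bar>) 1 (Suc n)"
  let ?C = "(\<Sum>i\<in>I. \<bar>rate i / i\<bar> * (1 + exp (- Re z * (t * i))) / Re z) ^ Suc n / fact (Suc n)"
  have "has_bochner_integral lborel
      (\<lambda>x. Re (exp (- of_real (Re z) * of_real x) * of_real (?S x)))
      (Re ((\<Sum>i\<in>I. of_real \<bar>rate i / i\<bar> *
        (1 + of_real 1 * exp (- of_real (Re z) * of_real (t * i))) / of_real (Re z)) ^ Suc n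
        / fact (Suc n)))"
    using assms by (intro has_bochner_integral_Re laplace_shifted_power_sum) auto
  also have "(\<Sum>i\<in>I. of_real \<bar>rate i / i\<bar> *
        (1 + of_real 1 * exp (- of_real (Re z) * of_real (t * i))) / of_real (Re z)) ^ Suc n
        / fact (Suc n) = complex_of_real ?C"
    by (simp del: power_Suc fact_Suc add: exp_of_real[symmetric])
  also have "(\<lambda>x. Re (exp (- of_real (Re z) * of_real x) * of_real (?S x))) =
      (\<lambda>x. exp (- Re z * x) * ?S x)"
    by (simp add: exp_of_real fun_eq_iff flip: of_real_mult of_real_minus)
  finally have S: "has_bochner_integral lborel (\<lambda>x. exp (- Re z * x) * ?S x) ?C"
    by (simp only: Re_complex_of_real)
  have "(LINT x|lborel. norm (exp (- z * of_real x) * of_real (density_term I rate t (Suc n) x)))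
      \<le> (LINT x|lborel. exp (- Re z * x) * ?S x)"
  proof (rule integral_mono)
    show "integrable lborel
        (\<lambda>x. norm (exp (- z * of_real x) * of_real (density_term I rate t (Suc n) x)))"
      unfolding density_term_eq_shifted_power_sum
      by (rule integrable_norm, rule integrable.intros, rule laplace_shifted_power_sum[OF assms])
    show "integrable lborel (\<lambda>x. exp (- Re z * x) * ?S x)"
      using S by (rule integrable.intros)
    show "norm (exp (- z * of_real x) * of_real (density_term I rate t (Suc n) x)) \<le>
        exp (- Re z * x) * ?S x" for x
    proof -
      have "norm (exp (- z * of_real x) * of_real (density_term I rate t (Suc n) x)) =
          exp (- Re z * x) * \<bar>density_term I rate t (Suc n) x\<bar>"
        by (simp add: norm_mult)
      also have "\<dots> \<le> exp (- Re z * x) * ?S x"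
        by (intro mult_left_mono abs_density_term_le) simp
      finally show ?thesis .
    qed
  qed
  also have "\<dots> = ?C" using S by (rule has_bochner_integral_integral_eq)
  finally show ?thesis .
qed

text \<open>The L1 norms of the terms are summable, so sum and integral may be exchanged. The
  exponential series then lacks its term for \<open>n = 0\<close>, which accounts for the
  \<open>- 1\<close>.\<close>

lemma laplace_integral_density:
  assumes "finite I" "0 < Re z"
  shows "has_bochner_integral lborel
    (\<lambda>x. exp (- z * of_real x) * of_real (integral_density I rate t x))
    (exp (- of_real ((\<Sum>i\<in>I. rate i) * t)) *
      (exp (\<Sum>i\<in>I. of_real (rate i / i) * (1 - exp (- z * of_real (t * i))) / z) - 1))"
proof -
  let ?f = "\<lambda>n x. exp (- z * of_real x) * of_real (density_term I rate t (Suc n) x)"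
  let ?\<Phi> = "\<Sum>i\<in>I. of_real (rate i / i) * (1 - exp (- z * of_real (t * i))) / z"
  have f: "has_bochner_integral lborel (?f n) (?\<Phi> ^ Suc n / fact (Suc n))" for n
    using laplace_shifted_power_sum[OF assms, of t "\<lambda>i. rate i / i" "- 1" n]
    by (simp add: density_term_eq_shifted_power_sum)
  have int: "integrable lborel (?f n)" for n
    using f by (rule integrable.intros)
  have sumn: "AE x in lborel. summable (\<lambda>n. norm (?f n x))"
    using summable_density_term[OF assms(1)] by (auto simp: norm_mult intro!: summable_mult)
  have sumi: "summable (\<lambda>n. LINT x|lborel. norm (?f n x))"
    using laplace_density_term_norm[OF assms]
    by (intro summable_comparison_test'[OF summable_Suc_exp]) auto
  have "(\<lambda>n. ?\<Phi> ^ n / fact n) sums exp ?\<Phi>"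
    using exp_converges[of ?\<Phi>] by (simp add: scaleR_conv_of_real field_simps)
  then have "(\<lambda>n. ?\<Phi> ^ Suc n / fact (Suc n)) sums (exp ?\<Phi> - 1)"
    by (subst sums_Suc_iff) simp
  moreover have "(\<lambda>n. ?\<Phi> ^ Suc n / fact (Suc n)) sums (LINT x|lborel. (\<Sum>n. ?f n x))"
    using sums_integral[OF int sumn sumi] by (simp only: has_bochner_integral_integral_eq[OF f])
  ultimately have "has_bochner_integral lborel (\<lambda>x. \<Sum>n. ?f n x) (exp ?\<Phi> - 1)"
    using integrable_suminf[OF int sumn sumi]
    by (simp only: has_bochner_integral_iff) (blast intro: sums_unique2)
  then have "has_bochner_integral lborel
      (\<lambda>x. exp (- of_real ((\<Sum>i\<in>I. rate i) * t)) * (\<Sum>n. ?f n x))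
      (exp (- of_real ((\<Sum>i\<in>I. rate i) * t)) * (exp ?\<Phi> - 1))"
    by (rule has_bochner_integral_mult_right)
  also have "(\<lambda>x. exp (- of_real ((\<Sum>i\<in>I. rate i) * t)) * (\<Sum>n. ?f n x)) =
      (\<lambda>x. exp (- z * of_real x) * of_real (integral_density I rate t x))"
  proof
    fix x
    have s: "summable (\<lambda>n. density_term I rate t (Suc n) x)"
      using summable_density_term[OF assms(1)] by (rule summable_norm_cancel)
    have "(\<Sum>n. ?f n x) = exp (- z * of_real x) * (\<Sum>n. of_real (density_term I rate t (Suc n) x))"
      using s by (intro suminf_mult summable_of_real)
    also have "(\<Sum>n. of_real (density_term I rate t (Suc n) x)) =
        complex_of_real (\<Sum>n. density_term I rate t (Suc n) x)"
      using s by (rule suminf_of_real[symmetric])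
    finally show "exp (- of_real ((\<Sum>i\<in>I. rate i) * t)) * (\<Sum>n. ?f n x) =
        exp (- z * of_real x) * of_real (integral_density I rate t x)"
      by (simp only: integral_density_def of_real_mult exp_of_real[symmetric] of_real_minus
          mult_minus_left mult_minus_right mult_ac)
  qed
  finally show ?thesis .
qed

section \<open>Uniqueness of Fourier transforms of finite measures\<close>

text \<open>Allows the negative part of a signed density to be moved across an equation between
  measures. The sigma-algebra is taken from \<open>M\<close>, so the facts on values and integrals
  ask for \<open>sets M = sets N\<close>.\<close>

definition add_measure :: "'a measure \<Rightarrow> 'a measure \<Rightarrow> 'a measure" where
  "add_measure M N = measure_of (space M) (sets M) (\<lambda>A. emeasure M A + emeasure N A)"

lemma space_add_measure [simp]: "space (add_measure M N) = space M"
  and sets_add_measure [simp, measurable_cong]: "sets (add_measure M N) = sets M"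
  by (simp_all add: add_measure_def)

lemma emeasure_add_measure:
  assumes "sets M = sets N" "A \<in> sets M"
  shows "emeasure (add_measure M N) A = emeasure M A + emeasure N A"
  unfolding add_measure_def
proof (rule emeasure_measure_of_sigma)
  show "sigma_algebra (space M) (sets M)" by (rule sets.sigma_algebra_axioms)
  show "positive (sets M) (\<lambda>A. emeasure M A + emeasure N A)" by (simp add: positive_def)
  show "countably_additive (sets M) (\<lambda>A. emeasure M A + emeasure N A)"
  proof (rule countably_additiveI)
    fix B :: "nat \<Rightarrow> 'a set"
    assume B: "range B \<subseteq> sets M" "disjoint_family B" "\<Union> (range B) \<in> sets M"
    show "(\<Sum>i. emeasure M (B i) + emeasure N (B i)) =
        emeasure M (\<Union> (range B)) + emeasure N (\<Union> (range B))"
      using B assms(1) by (subst suminf_add[symmetric]) (auto simp: suminf_emeasure)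
  qed
qed (rule assms)

lemma integral_add_measure:
  fixes f :: "'a \<Rightarrow> 'b::{banach, second_countable_topology}"
  assumes sets: "sets M = sets N" and "integrable (add_measure M N) f"
  shows "integrable M f \<and> integrable N f \<and>
    integral\<^sup>L (add_measure M N) f = integral\<^sup>L M f + integral\<^sup>L N f"
  using assms(2)
proof (induction rule: integrable_induct)
  case (base A c)
  then have A: "A \<in> sets M" "A \<in> sets N" "emeasure M A < \<infinity>" "emeasure N A < \<infinity>"
    using sets by (auto simp: emeasure_add_measure)
  moreover have "measure (add_measure M N) A = measure M A + measure N A"
    using A sets by (simp add: measure_def emeasure_add_measure enn2real_plus)
  moreover have "A \<inter> space M = A" "A \<inter> space N = A"
    using A sets.sets_into_space by blast+
  moreover have "A \<in> sets (add_measure M N)" "emeasure (add_measure M N) A < \<infinity>"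
    using base by auto
  ultimately show ?case
    by (simp add: scaleR_left_distrib)
next
  case (lim f s)
  let ?S = "add_measure M N"
  have le: "M \<le> ?S" "N \<le> ?S"
    using sets by (auto simp: le_measure emeasure_add_measure)
  \<comment> \<open>Each of \<open>M\<close>, \<open>N\<close> and their sum lies below the sum in
    the order of measures. Hence integrability of \<open>f\<close> passes down, and
    \<open>2 * norm (f x)\<close> dominates the approximants under all three.\<close>
  have f: "integrable K f \<and> (\<lambda>i. integral\<^sup>L K (s i)) \<longlonglongrightarrow> integral\<^sup>L K f"
    if K: "sets K = sets M" "K \<le> ?S" for K
  proof
    have m [measurable]: "f \<in> borel_measurable K" "s i \<in> borel_measurable K" for i
      using borel_measurable_integrable[OF lim.hyps(4)] borel_measurable_integrable[OF lim.hyps(1)] K(1)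
      by (simp_all cong: measurable_cong_sets)
    have "(\<integral>\<^sup>+x. norm (f x) \<partial>K) \<le> (\<integral>\<^sup>+x. norm (f x) \<partial>?S)"
      using K by (intro nn_integral_mono_measure) auto
    also have "\<dots> < \<infinity>" using lim.hyps(4) by (simp add: integrable_iff_bounded)
    finally show fK: "integrable K f" by (simp add: integrable_iff_bounded)
    have sp: "space K = space M" using K(1) by (rule sets_eq_imp_space_eq)
    show "(\<lambda>i. integral\<^sup>L K (s i)) \<longlonglongrightarrow> integral\<^sup>L K f"
      by (rule integral_dominated_convergence[where w = "\<lambda>x. 2 * norm (f x)"])
        (use fK lim.hyps(2,3) sp in auto)
  qed
  have "(\<lambda>i. integral\<^sup>L ?S (s i)) \<longlonglongrightarrow> integral\<^sup>L ?S f"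
    using f[of ?S] by simp
  moreover have "(\<lambda>i. integral\<^sup>L M (s i) + integral\<^sup>L N (s i)) \<longlonglongrightarrow>
      integral\<^sup>L M f + integral\<^sup>L N f"
    using f[of M] f[of N] le sets by (intro tendsto_add) auto
  ultimately show ?case
    using f[of M] f[of N] le sets lim.IH by (auto intro: LIMSEQ_unique)
qed auto

text \<open>At \<open>u = 0\<close> the transforms give the total masses, which therefore agree. If
  the common mass \<open>c\<close> is zero both measures vanish; otherwise dividing by
  \<open>c\<close> reduces to Levy uniqueness for probability distributions.\<close>

lemma fourier_uniqueness:
  fixes M N :: "real measure"
  assumes M: "finite_measure M" "sets M = sets borel"
    and N: "finite_measure N" "sets N = sets borel"
    and eq: "\<And>u. (LINT x|M. iexp (u * x)) = (LINT x|N. iexp (u * x))"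
  shows "M = N"
proof -
  interpret M: finite_measure M by fact
  interpret N: finite_measure N by fact
  have sp: "space M = UNIV" "space N = UNIV"
    using M(2)[THEN sets_eq_imp_space_eq] N(2)[THEN sets_eq_imp_space_eq] by simp_all
  define c where "c = measure M UNIV"
  have c: "measure N UNIV = c"
    using eq[of 0] by (simp add: c_def sp)
  show ?thesis
  proof (cases "c = 0")
    case True
    then have "emeasure M UNIV = 0" "emeasure N UNIV = 0"
      using c by (simp_all add: c_def M.emeasure_eq_measure N.emeasure_eq_measure)
    then have "emeasure M A = 0" "emeasure N A = 0" for A
      using emeasure_space[of M A] emeasure_space[of N A] by (simp_all add: sp)
    then show ?thesis using M N by (intro measure_eqI) auto
  next
    case False
    then have c0: "0 < c" unfolding c_def by (simp add: zero_less_measure_iff)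
    let ?d = "\<lambda>M :: real measure. density M (\<lambda>_. ennreal (1 / c))"
    have dist: "real_distribution (?d K)"
      if "finite_measure K" "sets K = sets borel" "measure K UNIV = c" for K
    proof -
      interpret K: finite_measure K by fact
      have "space K = UNIV" using that(2)[THEN sets_eq_imp_space_eq] by simp
      then have "emeasure (?d K) (space (?d K)) = 1"
        using that c0
        by (simp add: emeasure_density_const K.emeasure_eq_measure ennreal_mult[symmetric])
      then show ?thesis
        using that(2) by (intro real_distribution.intro prob_spaceI real_distribution_axioms.intro) auto
    qed
    have ch: "char (?d K) u = (LINT x|K. iexp (u * x)) / c" if "sets K = sets borel" for K u
      unfolding char_def using that c0
      by (subst integral_density) (auto simp: scaleR_conv_of_real measurable_cong_sets[OF that refl])
    have "?d M = ?d N"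
    proof (rule Levy_uniqueness)
      show "real_distribution (?d M)" "real_distribution (?d N)"
        by (rule dist[OF M c_def[symmetric]], rule dist[OF N c])
      show "char (?d M) = char (?d N)"
        unfolding ch[OF M(2)] ch[OF N(2)] fun_eq_iff eq by simp
    qed
    then have d: "emeasure (?d M) A = emeasure (?d N) A" for A by simp
    have mult: "ennreal (1 / c) * emeasure M A = ennreal (1 / c) * emeasure N A"
      if "A \<in> sets borel" for A
    proof -
      have "A \<in> sets M" "A \<in> sets N" using that M(2) N(2) by auto
      then show ?thesis using d[of A] by (simp only: emeasure_density_const)
    qed
    have "emeasure M A = emeasure N A" if "A \<in> sets borel" for A
    proof -
      have "0 < 1 / c" using c0 by simp
      then have "ennreal (1 / c) \<noteq> 0" by (simp only: ennreal_eq_0_iff not_le)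
      then show ?thesis
        using mult[OF that] by (simp only: ennreal_mult_cancel_left ennreal_neq_top) simp
    qed
    then show ?thesis using M N by (intro measure_eqI) auto
  qed
qed

lemma finite_measure_add_measure:
  assumes "sets M = sets N" "finite_measure M" "finite_measure N"
  shows "finite_measure (add_measure M N)"
proof
  interpret M: finite_measure M by fact
  interpret N: finite_measure N by fact
  show "emeasure (add_measure M N) (space (add_measure M N)) \<noteq> \<infinity>"
    by (simp add: emeasure_add_measure[OF assms(1) sets.top]
        M.emeasure_eq_measure N.emeasure_eq_measure)
qed

lemma finite_measure_density:
  assumes "integrable M f" "\<And>x. 0 \<le> f x"
  shows "finite_measure (density M (\<lambda>x. ennreal (f x)))"
proof
  have "(\<integral>\<^sup>+x. ennreal (f x) \<partial>M) < \<infinity>"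
    using assms by (simp add: nn_integral_eq_integral)
  then show "emeasure (density M f) (space (density M f)) \<noteq> \<infinity>"
    using borel_measurable_integrable[OF assms(1)]
    by (simp add: emeasure_density nn_set_integral_space less_top)
qed

lemma fourier_add_density:
  fixes K L :: "real measure"
  assumes K: "sets K = sets borel" "integrable K f" "\<And>x. 0 \<le> f x"
    and L: "sets L = sets borel" "integrable L g" "\<And>x. 0 \<le> g x"
  shows "(LINT x|add_measure (density K (\<lambda>x. ennreal (f x))) (density L (\<lambda>x. ennreal (g x))).
      iexp (u * x)) = (LINT x|K. f x *\<^sub>R iexp (u * x)) + (LINT x|L. g x *\<^sub>R iexp (u * x))"
proof -
  let ?K = "density K (\<lambda>x. ennreal (f x))" and ?L = "density L (\<lambda>x. ennreal (g x))"
  interpret finite_measure "add_measure ?K ?L"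
    using K L by (intro finite_measure_add_measure finite_measure_density) auto
  have "integrable (add_measure ?K ?L) (\<lambda>x. iexp (u * x))"
    using K(1) by (intro integrable_const_bound[where B = 1])
      (auto cong: measurable_cong_sets)
  from integral_add_measure[OF _ this] K(1) L(1)
  have "(LINT x|add_measure ?K ?L. iexp (u * x)) = (LINT x|?K. iexp (u * x)) + (LINT x|?L. iexp (u * x))"
    by simp
  also have "(LINT x|?K. iexp (u * x)) = (LINT x|K. f x *\<^sub>R iexp (u * x))"
    using K borel_measurable_integrable[OF K(2)]
    by (intro integral_density) (auto cong: measurable_cong_sets)
  also have "(LINT x|?L. iexp (u * x)) = (LINT x|L. g x *\<^sub>R iexp (u * x))"
    using L borel_measurable_integrable[OF L(2)]
    by (intro integral_density) (auto cong: measurable_cong_sets)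
  finally show ?thesis .
qed

section \<open>Recovering a density on the positive half-line\<close>

text \<open>Turns a Laplace transform on the line \<open>Re z = 1\<close> into a Fourier transform,
  at \<open>- u\<close>, of the measure weighted by \<open>exp (- x)\<close>.\<close>

lemma complex_exp_tilt: "exp (- (1 + \<i> * of_real u) * of_real x) = exp (- x) *\<^sub>R iexp (- u * x)"
  by (simp add: scaleR_conv_of_real exp_of_real[symmetric] exp_add[symmetric] algebra_simps)

text \<open>
  The sign of \<open>g\<close> is not known in advance, so Fourier uniqueness is applied after moving the
  negative part of the tilted \<open>g\<close> to the side of \<open>\<mu>\<close>; all four measures are then finite and positive.
\<close>

lemma density_on_pos_by_laplace:
  fixes \<mu> :: "real measure" and g :: "real \<Rightarrow> real" and p :: real
  assumes \<mu>: "real_distribution \<mu>" and e: "integrable \<mu> (\<lambda>x. exp (- x))"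
    and g [measurable]: "g \<in> borel_measurable borel" and p: "0 \<le> p"
    and L: "\<And>u. has_bochner_integral lborel
      (\<lambda>x. exp (- (1 + \<i> * of_real u) * of_real x) * of_real (g x))
      ((LINT x|\<mu>. exp (- (1 + \<i> * of_real u) * of_real x)) - of_real p)"
  shows "set_integrable lborel {0<..} g"
    and "\<And>A. A \<in> sets borel \<Longrightarrow> A \<subseteq> {0<..} \<Longrightarrow> measure \<mu> A = (LINT x:A|lborel. g x)"
proof -
  interpret real_distribution \<mu> by fact
  define G where "G = (\<lambda>x. exp (- x) * g x)"
  have Gm [measurable]: "G \<in> borel_measurable borel" unfolding G_def by simp
  have Gi: "integrable lborel G"
    using integrable_Re[OF integrable.intros[OF L[of 0]]]
    by (simp add: G_def exp_of_real flip: of_real_minus of_real_mult)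
  have GL: "has_bochner_integral lborel (\<lambda>x. G x *\<^sub>R iexp (u * x))
      ((LINT x|\<mu>. exp (- x) *\<^sub>R iexp (u * x)) - of_real p)" for u
    using L[of "- u"] unfolding complex_exp_tilt
    by (simp add: G_def scaleR_conv_of_real mult_ac)
  define Gp where "Gp = (\<lambda>x. max 0 (G x))"
  define Gn where "Gn = (\<lambda>x. max 0 (- G x))"
  have [measurable]: "Gp \<in> borel_measurable borel" "Gn \<in> borel_measurable borel"
    unfolding Gp_def Gn_def by simp_all
  have Gpn: "0 \<le> Gp x" "0 \<le> Gn x" "G x = Gp x - Gn x" for x
    by (auto simp: Gp_def Gn_def max_def)
  have Gn0: "ennreal (Gn x) = 0 \<longleftrightarrow> 0 \<le> g x" for x
    by (simp add: Gn_def G_def ennreal_eq_0_iff zero_le_mult_iff)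
  have Gpi: "integrable lborel Gp" and Gni: "integrable lborel Gn"
    unfolding Gp_def Gn_def
    by (intro integrable_max integrable_zero Gi Bochner_Integration.integrable_minus)+
  \<comment> \<open>The constant \<open>p\<close> is the Fourier transform of a point mass at 0,
    which therefore joins the positive part of \<open>G\<close> in \<open>?M2\<close>.\<close>
  let ?M1 = "add_measure (density \<mu> (\<lambda>x. ennreal (exp (- x)))) (density lborel (\<lambda>x. ennreal (Gn x)))"
  let ?M2 = "add_measure (density (return borel 0) (\<lambda>x. ennreal p)) (density lborel (\<lambda>x. ennreal (Gp x)))"
  interpret R: prob_space "return borel (0::real)" by (rule prob_space_return) simp
  have "?M1 = ?M2"
  proof (rule fourier_uniqueness)
    show "finite_measure ?M1"
      using e Gni Gpn(2) by (intro finite_measure_add_measure finite_measure_density) auto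
    show "finite_measure ?M2"
      using p Gpi Gpn(1) by (intro finite_measure_add_measure finite_measure_density) auto
    fix u
    let ?I = "\<lambda>G. LINT x|lborel. G x *\<^sub>R iexp (u * x)"
    have i: "integrable lborel (\<lambda>x. H x *\<^sub>R iexp (u * x))"
      if "integrable lborel H" for H :: "real \<Rightarrow> real"
      by (rule Bochner_Integration.integrable_bound[OF that])
        (use borel_measurable_integrable[OF that] in auto)
    have "?I G = ?I Gp - ?I Gn"
      unfolding Gpn(3) scaleR_left_diff_distrib
      by (intro Bochner_Integration.integral_diff i Gpi Gni)
    moreover have "?I G = (LINT x|\<mu>. exp (- x) *\<^sub>R iexp (u * x)) - of_real p"
      using GL by (rule has_bochner_integral_integral_eq)
    ultimately have A: "(LINT x|\<mu>. exp (- x) *\<^sub>R iexp (u * x)) = ?I Gp - ?I Gn + of_real p"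
      by (simp only: diff_eq_eq)
    have r: "(LINT x|return borel 0. p *\<^sub>R iexp (u * x)) = of_real p"
      by (subst integral_return) (auto simp: scaleR_conv_of_real)
    have "(LINT x|\<mu>. exp (- x) *\<^sub>R iexp (u * x)) + ?I Gn =
        (LINT x|return borel 0. p *\<^sub>R iexp (u * x)) + ?I Gp"
      unfolding A r by simp
    then show "(LINT x|?M1. iexp (u * x)) = (LINT x|?M2. iexp (u * x))"
      using e p Gpi Gni Gpn by (subst (1 2) fourier_add_density) auto
  qed auto
  then have M12: "emeasure ?M1 S = emeasure ?M2 S" for S by simp
  \<comment> \<open>Sets inside the open half-line do not see the point mass at 0.\<close>
  have S: "(\<integral>\<^sup>+x\<in>S. ennreal (exp (- x)) \<partial>\<mu>) + (\<integral>\<^sup>+x\<in>S. ennreal (Gn x) \<partial>lborel) =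
      (\<integral>\<^sup>+x\<in>S. ennreal (Gp x) \<partial>lborel)" if [measurable]: "S \<in> sets borel" and "S \<subseteq> {0<..}" for S
  proof -
    have "0 \<notin> S" using that(2) by auto
    then show ?thesis
      using M12[of S] by (simp add: emeasure_add_measure emeasure_density nn_integral_return)
  qed
  \<comment> \<open>Where \<open>G\<close> is negative, \<open>Gp\<close> vanishes, so by
    \<open>S\<close> both nonnegative terms on the other side vanish there too. Thus
    \<open>Gn\<close> is zero almost everywhere on a set where it is positive, which makes that set
    null.\<close>
  have nn: "AE x in lborel. 0 < x \<longrightarrow> 0 \<le> g x"
  proof -
    let ?S = "{x. 0 < x \<and> G x < 0}"
    have m: "?S \<in> sets borel" by measurable
    have "(\<integral>\<^sup>+x\<in>?S. ennreal (Gp x) \<partial>lborel) = (\<integral>\<^sup>+(x::real). 0 \<partial>lborel)"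
      by (intro nn_integral_cong) (auto simp: Gp_def max_def split: split_indicator)
    then have "(\<integral>\<^sup>+x\<in>?S. ennreal (Gn x) \<partial>lborel) = 0"
      using S[OF m] by (auto simp: add_eq_0_iff_both_eq_0)
    then have "AE x in lborel. ennreal (Gn x) * indicator ?S x = 0"
      using m by (subst (asm) nn_integral_0_iff_AE) auto
    then show ?thesis
      by eventually_elim (auto simp: Gn0 G_def indicator_def mult_less_0_iff)
  qed
  \<comment> \<open>With \<open>g\<close> nonnegative almost everywhere on the half-line,
    \<open>Gn\<close> drops out of \<open>S\<close>.\<close>
  have "density \<mu> (\<lambda>x. ennreal (exp (- x)) * indicator {0<..} x) =
      density lborel (\<lambda>x. ennreal (Gp x) * indicator {0<..} x)" (is "?D1 = ?D2")
  proof (rule measure_eqI)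
    fix A assume "A \<in> sets ?D1"
    then have [measurable]: "A \<in> sets borel" by simp
    let ?B = "A \<inter> {0<..}"
    have "AE x in lborel. ennreal (Gn x) * indicator ?B x = 0"
      using nn by eventually_elim (auto simp: Gn0 split: split_indicator)
    then have "(\<integral>\<^sup>+x\<in>?B. ennreal (Gn x) \<partial>lborel) = 0"
      by (subst nn_integral_0_iff_AE) auto
    then have "(\<integral>\<^sup>+x\<in>?B. ennreal (exp (- x)) \<partial>\<mu>) = (\<integral>\<^sup>+x\<in>?B. ennreal (Gp x) \<partial>lborel)"
      using S[of ?B] by simp
    then show "emeasure ?D1 A = emeasure ?D2 A"
      by (simp add: emeasure_density indicator_inter_arith mult_ac)
  qed simp
  \<comment> \<open>Multiplying by \<open>exp x\<close> undoes the tilt.\<close>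
  then have "density ?D1 (\<lambda>x. ennreal (exp x)) = density ?D2 (\<lambda>x. ennreal (exp x))" by simp
  then have D: "density \<mu> (\<lambda>x. ennreal (exp (- x)) * indicator {0<..} x * ennreal (exp x)) =
      density lborel (\<lambda>x. ennreal (Gp x) * indicator {0<..} x * ennreal (exp x))"
    by (simp add: density_density_eq)
  \<comment> \<open>\<open>ennreal\<close> sends negative numbers to 0, so
    \<open>ennreal (g x)\<close> is already the positive part, that is
    \<open>exp x * Gp x\<close>.\<close>
  have main: "emeasure \<mu> A = (\<integral>\<^sup>+x. ennreal (indicator A x * g x) \<partial>lborel)"
    if [measurable]: "A \<in> sets borel" and A: "A \<subseteq> {0<..}" for A
  proof -
    have "emeasure \<mu> A =
        (\<integral>\<^sup>+x\<in>A. (ennreal (exp (- x)) * indicator {0<..} x * ennreal (exp x)) \<partial>\<mu>)"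
    proof -
      have "(\<integral>\<^sup>+x\<in>A. (ennreal (exp (- x)) * indicator {0<..} x * ennreal (exp x)) \<partial>\<mu>) =
          (\<integral>\<^sup>+x. indicator A x \<partial>\<mu>)"
        using A by (intro nn_integral_cong)
          (auto simp: indicator_def subset_iff ennreal_mult[symmetric] exp_minus)
      then show ?thesis by simp
    qed
    also have "\<dots> = (\<integral>\<^sup>+x\<in>A. (ennreal (Gp x) * indicator {0<..} x * ennreal (exp x)) \<partial>lborel)"
      using arg_cong[OF D, of "\<lambda>M. emeasure M A"] by (simp add: emeasure_density)
    also have "\<dots> = (\<integral>\<^sup>+x. ennreal (indicator A x * g x) \<partial>lborel)"
      using A by (intro nn_integral_cong) (auto simp: Gp_def G_def max_def indicator_def subset_iff
          exp_minus mult_le_0_iff field_simps ennreal_neg ennreal_mult[symmetric] not_le)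
    finally show ?thesis .
  qed
  have nnA: "AE x in lborel. 0 \<le> indicator A x * g x" if "A \<subseteq> {0<..}" for A :: "real set"
    using nn by eventually_elim (use that in \<open>auto simp: indicator_def\<close>)
  \<comment> \<open>Integrability of \<open>g\<close> is a consequence of the identity
    \<open>main\<close>: its integral over \<open>A\<close> is a probability.\<close>
  have si: "integrable lborel (\<lambda>x. indicator A x * g x)"
    if [measurable]: "A \<in> sets borel" and A: "A \<subseteq> {0<..}" for A
  proof (rule integrableI_nonneg[OF _ nnA[OF A]])
    show "(\<integral>\<^sup>+x. ennreal (indicator A x * g x) \<partial>lborel) < \<infinity>"
      unfolding main[OF that, symmetric] by (simp add: less_top[symmetric])
  qed simp
  then show "set_integrable lborel {0<..} g" by (simp add: set_integrable_def)
  fix A :: "real set" assume A: "A \<in> sets borel" "A \<subseteq> {0<..}"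
  have "ennreal (measure \<mu> A) = emeasure \<mu> A" by (simp add: emeasure_eq_measure)
  also have "\<dots> = (\<integral>\<^sup>+x. ennreal (indicator A x * g x) \<partial>lborel)" using A by (rule main)
  also have "\<dots> = ennreal (LINT x|lborel. indicator A x * g x)"
    using A by (intro nn_integral_eq_integral si nnA)
  finally have "ennreal (measure \<mu> A) = ennreal (LINT x|lborel. indicator A x * g x)" .
  then show "measure \<mu> A = (LINT x:A|lborel. g x)"
    using integral_nonneg_AE[OF nnA[OF A(2)]] by (simp add: set_lebesgue_integral_def)
qed

section \<open>Laplace transform of the integrated process\<close>

text \<open>A monotone function is Borel measurable and, on a compact interval, bounded by its
  endpoint values.\<close>

lemma set_integrable_mono_on:
  fixes f :: "real \<Rightarrow> real"
  assumes "mono_on {a..b} f"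
  shows "set_integrable lborel {a..b} f"
proof -
  have "finite_measure (restrict_space lborel {a..b})"
    by (intro finite_measureI) (simp add: emeasure_restrict_space emeasure_lborel_Icc_eq)
  then interpret finite_measure "restrict_space lborel {a..b}" .
  have "f \<in> borel_measurable (restrict_space borel {a..b})"
    using assms by (rule borel_measurable_mono_on_fnc)
  then have "f \<in> borel_measurable (restrict_space lborel {a..b})"
    by (simp cong: measurable_cong_sets sets_restrict_space_cong)
  moreover have "\<bar>f x\<bar> \<le> max \<bar>f a\<bar> \<bar>f b\<bar>" if "x \<in> {a..b}" for x
    using mono_onD[OF assms, of a x] mono_onD[OF assms, of x b] that by auto
  ultimately have "integrable (restrict_space lborel {a..b}) f"
    by (intro integrable_const_bound[where B = "max \<bar>f a\<bar> \<bar>f b\<bar>"])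
      (auto simp: space_restrict_space intro!: AE_I2)
  then show ?thesis by (simp add: set_integrable_def integrable_restrict_space)
qed

text \<open>Induction on the number of cells; on the half-open cell added last, \<open>f\<close>
  lies between its values at the two endpoints.\<close>

lemma riemann_sum_bounds:
  fixes f :: "real \<Rightarrow> real"
  assumes f: "mono_on {0..} f" and h: "0 \<le> h"
  shows "h * (\<Sum>k<m. f (real k * h)) \<le> (LINT s:{0..real m * h}|lborel. f s) \<and>
    (LINT s:{0..real m * h}|lborel. f s) \<le> h * (\<Sum>k<m. f (real (Suc k) * h))"
proof (induction m)
  case 0
  \<comment> \<open>For \<open>m = 0\<close> the interval is the single point 0, a null set.\<close>
  have "AE s in lborel. indicator {0} s *\<^sub>R f s = 0"
    using AE_lborel_singleton[of "0::real"] by eventually_elim simp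
  then have "(LINT s:{0}|lborel. f s) = 0"
    unfolding set_lebesgue_integral_def by (rule integral_eq_zero_AE)
  then show ?case by simp
next
  case (Suc m)
  let ?a = "real m * h" and ?b = "real (Suc m) * h"
  have ab: "0 \<le> ?a" "?a \<le> ?b" using h by (auto intro: mult_right_mono)
  have int: "set_integrable lborel {0..?b} f"
    by (intro set_integrable_mono_on mono_on_subset[OF f]) auto
  have ints: "set_integrable lborel {0..?a} f" "set_integrable lborel {?a<..?b} f"
    by (rule set_integrable_subset[OF int]; use ab in auto)+
  have "{0..?b} = {0..?a} \<union> {?a<..?b}" using ab by auto
  then have eq: "(LINT s:{0..?b}|lborel. f s) =
      (LINT s:{0..?a}|lborel. f s) + (LINT s:{?a<..?b}|lborel. f s)"
    using ints by (simp add: set_integral_Un ivl_disj_int)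
  have c: "set_integrable lborel {?a<..?b} (\<lambda>_. c)" "(LINT s:{?a<..?b}|lborel. c) = h * c"
    for c :: real
    using ab by (auto simp: set_integrable_def set_lebesgue_integral_def algebra_simps)
  have "h * f ?a \<le> (LINT s:{?a<..?b}|lborel. f s)"
    using ab unfolding c(2)[symmetric]
    by (intro set_integral_mono c ints) (auto intro!: mono_onD[OF f])
  moreover have "(LINT s:{?a<..?b}|lborel. f s) \<le> h * f ?b"
    using ab unfolding c(2)[symmetric]
    by (intro set_integral_mono c ints) (auto intro!: mono_onD[OF f])
  ultimately show ?case
    using Suc unfolding eq by (simp add: distrib_left)
qed

text \<open>The integral lies between the lower and upper sums, whose difference telescopes to the
  mesh times \<open>f t - f 0\<close> and so tends to 0.\<close>

lemma riemann_sum_tendsto: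
  fixes f :: "real \<Rightarrow> real"
  assumes f: "mono_on {0..} f" and t: "0 \<le> t"
  shows "(\<lambda>m. t / real (Suc m) * (\<Sum>k<Suc m. f (real (Suc k) * (t / real (Suc m)))))
    \<longlonglongrightarrow> (LINT s:{0..t}|lborel. f s)"
proof (rule tendsto_sandwich)
  let ?h = "\<lambda>m. t / real (Suc m)"
  let ?I = "LINT s:{0..t}|lborel. f s"
  have b: "?h m * (\<Sum>k<Suc m. f (real k * ?h m)) \<le> ?I \<and>
      ?I \<le> ?h m * (\<Sum>k<Suc m. f (real (Suc k) * ?h m))" for m
  proof -
    have "real (Suc m) * ?h m = t" by simp
    then show ?thesis
      using riemann_sum_bounds[OF f, of "?h m" "Suc m"] t by simp
  qed
  show "\<forall>\<^sub>F m in sequentially. ?I \<le> ?h m * (\<Sum>k<Suc m. f (real (Suc k) * ?h m))"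
    using b by simp
  have "(\<Sum>k<Suc m. f (real (Suc k) * ?h m)) - (\<Sum>k<Suc m. f (real k * ?h m)) = f t - f 0" for m
    unfolding sum_subtractf[symmetric]
    by (subst sum_lessThan_telescope) simp
  then have "?h m * (\<Sum>k<Suc m. f (real (Suc k) * ?h m)) =
      ?h m * (\<Sum>k<Suc m. f (real k * ?h m)) + ?h m * (f t - f 0)" for m
    by (metis add_diff_cancel_left' diff_add_cancel distrib_left add.commute)
  then show "\<forall>\<^sub>F m in sequentially. ?h m * (\<Sum>k<Suc m. f (real (Suc k) * ?h m)) \<le>
      ?I + ?h m * (f t - f 0)"
    using b by simp
  have "(\<lambda>m. ?h m) \<longlonglongrightarrow> 0" by (rule LIMSEQ_Suc[OF lim_const_over_n])
  then have "(\<lambda>m. ?I + ?h m * (f t - f 0)) \<longlonglongrightarrow> ?I + 0 * (f t - f 0)"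
    by (intro tendsto_intros)
  then show "(\<lambda>m. ?I + ?h m * (f t - f 0)) \<longlonglongrightarrow> ?I" by simp
qed simp

text \<open>The \<open>k\<close>-th increment contributes to \<open>a (Suc k)\<close> up to
  \<open>a m\<close>, hence \<open>m - k\<close> times.\<close>

lemma sum_by_parts_weighted_increments:
  fixes a :: "nat \<Rightarrow> real"
  assumes "a 0 = 0"
  shows "(\<Sum>k<m. a (Suc k)) = (\<Sum>k<m. real (m - k) * (a (Suc k) - a k))"
proof (induction m)
  case (Suc m)
  have "(\<Sum>k<Suc m. real (Suc m - k) * (a (Suc k) - a k)) =
      (\<Sum>k<Suc m. real (m - k) * (a (Suc k) - a k) + (a (Suc k) - a k))"
    by (intro sum.cong) (auto simp: Suc_diff_le algebra_simps)
  also have "\<dots> = (\<Sum>k<m. real (m - k) * (a (Suc k) - a k)) + a (Suc m)"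
    using assms by (simp add: sum.distrib sum_lessThan_telescope)
  finally show ?case using Suc by simp
qed simp

section \<open>Exponential moments of Poisson variables and of Riemann sums\<close>

text \<open>Against counting measure the expectation is an exponential series. The general field
  serves both the complex transform and the real dominating function.\<close>

lemma poisson_exp_moment:
  fixes v :: "'b::{real_normed_field, banach, second_countable_topology}"
  assumes "0 < r"
  shows "has_bochner_integral (measure_pmf (poisson_pmf r)) (\<lambda>n. exp (v * of_nat n))
    (exp (of_real r * (exp v - 1)))"
proof -
  let ?g = "\<lambda>n. pmf (poisson_pmf r) n *\<^sub>R exp (v * of_nat n)"
  have g: "?g n = exp (- of_real r) * ((of_real r * exp v) ^ n /\<^sub>R fact n)" for n
    by (simp add: pmf_poisson[OF assms] scaleR_conv_of_real exp_of_real[symmetric] power_mult_distrib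
        exp_of_nat2_mult divide_simps)
  have ng: "norm (?g n) = exp (- r) * ((r * norm (exp v)) ^ n /\<^sub>R fact n)" for n
    using assms by (simp add: pmf_poisson[OF assms] power_mult_distrib exp_of_nat2_mult norm_power norm_mult divide_simps)
  have "summable (\<lambda>n. norm (?g n))"
    unfolding ng by (intro summable_mult summable_exp_generic)
  then have int: "integrable (count_space UNIV) ?g"
    by (simp add: integrable_count_space_nat_iff)
  have "?g sums (exp (- of_real r) * exp (of_real r * exp v))"
    unfolding g by (intro sums_mult exp_converges)
  then have "integral\<^sup>L (count_space UNIV) ?g = exp (- of_real r) * exp (of_real r * exp v)"
    using sums_integral_count_space_nat[OF int] by (rule sums_unique2[rotated])
  also have "\<dots> = exp (of_real r * (exp v - 1))"
    by (simp add: algebra_simps flip: exp_add)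
  finally have "has_bochner_integral (count_space UNIV) ?g (exp (of_real r * (exp v - 1)))"
    using int by (simp add: has_bochner_integral_iff)
  then show ?thesis
    unfolding measure_pmf_eq_density by (intro has_bochner_integral_density) auto
qed

context prob_space begin

lemma poisson_process_increment_exp:
  fixes v :: "'b::{real_normed_field, banach, second_countable_topology}"
  assumes N: "poisson_process r N" and s: "0 \<le> s" "s < u"
  shows "has_bochner_integral M (\<lambda>\<omega>. exp (v * of_nat (N u \<omega> - N s \<omega>)))
    (exp (of_real (r * (u - s)) * (exp v - 1)))"
proof -
  have [measurable]: "random_variable (count_space UNIV) (N x)" if "0 \<le> x" for x
    using N that by (simp add: poisson_process_def)
  have [measurable]: "random_variable (count_space UNIV) (\<lambda>\<omega>. N u \<omega> - N s \<omega>)"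
    using s order.trans[OF s(1) less_imp_le[OF s(2)]] by measurable
  have D: "distr M (count_space UNIV) (\<lambda>\<omega>. N u \<omega> - N s \<omega>) =
      measure_pmf (poisson_pmf (r * (u - s)))"
    using N s by (simp add: poisson_process_def)
  have "0 < r * (u - s)" using N s by (simp add: poisson_process_def)
  from poisson_exp_moment[OF this, of v] show ?thesis
    unfolding D[symmetric] has_bochner_integral_iff
    by (simp add: integrable_distr_eq integral_distr)
qed

text \<open>Summation by parts turns the Riemann sum into a combination of independent increments
  with weights \<open>h * (m - k)\<close>, so the expectation of the exponential factors.\<close>

lemma poisson_process_riemann_sum_exp:
  fixes v :: "'b::{real_normed_field, banach, second_countable_topology}"
  assumes N: "poisson_process r N" and h: "0 < h"
  shows "has_bochner_integral M
    (\<lambda>\<omega>. exp (v * of_real (h * (\<Sum>k<m. real (N (real (Suc k) * h) \<omega>)))))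
    (\<Prod>k<m. exp (of_real (r * h) * (exp (v * of_real h) ^ Suc k - 1)))"
proof -
  let ?D = "\<lambda>k \<omega>. N (real (Suc k) * h) \<omega> - N (real k * h) \<omega>"
  let ?X = "\<lambda>k \<omega>. exp (v * of_real h * of_nat (m - k) * of_nat (?D k \<omega>))"
  have "indep_vars (\<lambda>_. count_space UNIV) ?D {..<m}"
  proof -
    have "\<forall>(n::nat) \<tau> :: nat \<Rightarrow> real. 0 \<le> \<tau> 0 \<longrightarrow> (\<forall>k<n. \<tau> k < \<tau> (Suc k)) \<longrightarrow>
        indep_vars (\<lambda>_. count_space UNIV) (\<lambda>k \<omega>. N (\<tau> (Suc k)) \<omega> - N (\<tau> k) \<omega>) {..<n}"
      using N by (simp add: poisson_process_def)
    from this[rule_format, of "\<lambda>k. real k * h" m] h show ?thesis by simp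
  qed
  then have indep: "indep_vars (\<lambda>_. borel) ?X {..<m}"
    by (rule indep_vars_compose2) simp
  have X: "has_bochner_integral M (?X k)
      (exp (of_real (r * h) * (exp (v * of_real h * of_nat (m - k)) - 1)))" for k
    using poisson_process_increment_exp[OF N, of "real k * h" "real (Suc k) * h"
        "v * of_real h * of_nat (m - k)"] h by (simp add: algebra_simps)
  have int: "integrable M (?X k)" for k using X by (rule integrable.intros)
  have "has_bochner_integral M (\<lambda>\<omega>. \<Prod>k<m. ?X k \<omega>)
      (\<Prod>k<m. exp (of_real (r * h) * (exp (v * of_real h * of_nat (m - k)) - 1)))"
    using indep_vars_lebesgue_integral[OF _ indep int] indep_vars_integrable[OF _ indep int]
      has_bochner_integral_integral_eq[OF X]
    by (simp add: has_bochner_integral_iff del: of_nat_diff of_nat_Suc of_real_mult)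
  \<comment> \<open>Reversing the order of the cells replaces the weight \<open>m - k\<close> by
    \<open>Suc k\<close>, which prepares a geometric sum.\<close>
  also have "(\<Prod>k<m. exp (of_real (r * h) * (exp (v * of_real h * of_nat (m - k)) - 1))) =
      (\<Prod>k<m. exp (of_real (r * h) * (exp (v * of_real h) ^ Suc k - 1)))"
    by (rule prod.reindex_bij_witness[where i = "\<lambda>k. m - Suc k" and j = "\<lambda>k. m - Suc k"])
      (auto simp: Suc_diff_Suc exp_of_nat2_mult simp del: power_Suc of_nat_Suc of_nat_diff)
  also have "has_bochner_integral M (\<lambda>\<omega>. \<Prod>k<m. ?X k \<omega>) y \<longleftrightarrow> has_bochner_integral M
      (\<lambda>\<omega>. exp (v * of_real (h * (\<Sum>k<m. real (N (real (Suc k) * h) \<omega>))))) y" for y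
  proof (intro has_bochner_integral_cong refl)
    fix \<omega> assume \<omega>: "\<omega> \<in> space M"
    \<comment> \<open>Monotone paths make the differences of natural numbers agree with those of
      reals.\<close>
    have mono: "N (real k * h) \<omega> \<le> N (real (Suc k) * h) \<omega>" for k
      using N \<omega> h by (auto simp: poisson_process_def intro!: mono_onD[of "{0..}" "\<lambda>s. N s \<omega>"])
    have "(\<Sum>k<m. real (N (real (Suc k) * h) \<omega>)) = (\<Sum>k<m. real (m - k) * real (?D k \<omega>))"
      using sum_by_parts_weighted_increments[of "\<lambda>k. real (N (real k * h) \<omega>)" m] N \<omega>
      by (simp add: poisson_process_def of_nat_diff[OF mono] del: of_nat_Suc)
    then show "(\<Prod>k<m. ?X k \<omega>) = exp (v * of_real (h * (\<Sum>k<m. real (N (real (Suc k) * h) \<omega>))))"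
      by (simp add: exp_sum[symmetric] sum_distrib_left mult_ac del: of_nat_Suc of_nat_diff)
  qed
  finally show ?thesis .
qed

end

section \<open>Limit of the transforms of the Riemann sums\<close>

text \<open>The exponents add up to a geometric sum in \<open>q = exp (w * h)\<close>, whose
  \<open>Suc m\<close>-th power is \<open>exp (w * t)\<close>. What remains depends on
  \<open>m\<close> only through \<open>q\<close>, which tends to 1, and \<open>(q - 1) / h\<close>,
  which tends to the derivative \<open>w\<close>.\<close>

lemma exp_riemann_prod_tendsto:
  fixes w :: complex and r t :: real
  assumes w: "Re w \<noteq> 0" and t: "0 < t"
  shows "(\<lambda>m. \<Prod>k<Suc m. exp (of_real (r * (t / real (Suc m))) *
      (exp (w * of_real (t / real (Suc m))) ^ Suc k - 1)))
    \<longlonglongrightarrow> exp (of_real r * ((exp (w * of_real t) - 1) / w - of_real t))"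
proof -
  let ?h = "\<lambda>m. t / real (Suc m)"
  let ?q = "\<lambda>m. exp (w * of_real (?h m))"
  have w0: "w \<noteq> 0" using w by auto
  \<comment> \<open>Since \<open>Re w\<close> is nonzero, \<open>q\<close> is off the unit circle,
    so the geometric sum formula applies for every \<open>m\<close>.\<close>
  have q: "?q m \<noteq> 1" for m
  proof
    assume "?q m = 1"
    then have "norm (?q m) = 1" by simp
    then show False using w t by (simp add: mult_eq_0_iff)
  qed
  have h0: "?h \<longlonglongrightarrow> 0" by (rule LIMSEQ_Suc[OF lim_const_over_n])
  have "((\<lambda>x. exp (w * x)) has_field_derivative w) (at 0)"
    by (auto intro!: derivative_eq_intros)
  then have "((\<lambda>x. (exp (w * x) - 1) / x) \<longlongrightarrow> w) (at 0)"
    by (simp add: has_field_derivative_iff)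
  moreover have "filterlim (\<lambda>m. complex_of_real (?h m)) (at 0) sequentially"
    using t tendsto_of_real[OF h0, where ?'a = complex] by (simp add: filterlim_at del: of_nat_Suc of_real_divide)
  ultimately have "(\<lambda>m. (?q m - 1) / of_real (?h m)) \<longlonglongrightarrow> w"
    by (rule filterlim_compose)
  then have "(\<lambda>m. exp (of_real r * (?q m * (exp (w * of_real t) - 1) *
      inverse ((?q m - 1) / of_real (?h m)) - of_real t))) \<longlonglongrightarrow>
      exp (of_real r * (exp (w * of_real 0) * (exp (w * of_real t) - 1) * inverse w - of_real t))"
    using h0 w0 by (intro tendsto_intros \<open>(\<lambda>m. (?q m - 1) / of_real (?h m)) \<longlonglongrightarrow> w\<close>)
  also have "exp (of_real r * (exp (w * of_real 0) * (exp (w * of_real t) - 1) * inverse w - of_real t)) =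
      exp (of_real r * ((exp (w * of_real t) - 1) / w - of_real t))"
    by (simp add: divide_inverse)
  also have "(\<lambda>m. exp (of_real r * (?q m * (exp (w * of_real t) - 1) *
      inverse ((?q m - 1) / of_real (?h m)) - of_real t))) =
      (\<lambda>m. \<Prod>k<Suc m. exp (of_real (r * ?h m) * (?q m ^ Suc k - 1)))"
  proof
    fix m
    have qt: "?q m ^ Suc m = exp (w * of_real t)"
      by (subst exp_of_nat_mult[symmetric]) (simp add: field_simps del: of_nat_Suc)
    have ht: "of_real (?h m) * of_nat (Suc m) = complex_of_real t"
      by (simp del: of_nat_Suc)
    have "(\<Sum>k<Suc m. ?q m ^ Suc k - 1) = ?q m * (\<Sum>k<Suc m. ?q m ^ k) - of_nat (Suc m)"
      by (simp only: sum_subtractf sum_distrib_left power_Suc) simp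
    also have "(\<Sum>k<Suc m. ?q m ^ k) = (exp (w * of_real t) - 1) / (?q m - 1)"
      by (simp only: geometric_sum[OF q] qt)
    finally have "of_real (r * ?h m) * (\<Sum>k<Suc m. ?q m ^ Suc k - 1) =
        of_real r * (of_real (?h m) * (?q m * ((exp (w * of_real t) - 1) / (?q m - 1))) -
          of_real (?h m) * of_nat (Suc m))"
      by (simp only: of_real_mult right_diff_distrib mult.assoc)
    also have "\<dots> = of_real r * (?q m * (exp (w * of_real t) - 1) *
        inverse ((?q m - 1) / of_real (?h m)) - of_real t)"
      unfolding ht by (simp only: inverse_divide times_divide_eq_right mult_ac)
    finally show "exp (of_real r * (?q m * (exp (w * of_real t) - 1) *
        inverse ((?q m - 1) / of_real (?h m)) - of_real t)) =
        (\<Prod>k<Suc m. exp (of_real (r * ?h m) * (?q m ^ Suc k - 1)))"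
      by (subst exp_sum[symmetric]) (simp_all only: finite_lessThan sum_distrib_left[symmetric])
  qed
  finally show ?thesis .
qed

context prob_space begin

text \<open>
  The Riemann sums are functions of finitely many coordinates of the paths, so their joint
  independence comes directly from the independence of the processes, and their Laplace
  transforms from the independent increments.
\<close>

lemma laplace_weighted_integral:
  fixes I :: "real set" and N :: "real \<Rightarrow> real \<Rightarrow> 'a \<Rightarrow> nat"
  assumes I: "finite I" "0 \<notin> I"
    and N: "\<forall>i\<in>I. poisson_process (rate i) (N i)" and indep: "indep_processes N I"
    and t: "0 < t"
  defines "Y \<equiv> \<lambda>\<omega>. LINT s:{0..t}|lborel. weighted_sum_process I N s \<omega>"
  shows "\<And>\<omega>. \<omega> \<in> space M \<Longrightarrow> set_integrable lborel {0..t} (\<lambda>s. weighted_sum_process I N s \<omega>)"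
    and "random_variable borel Y"
    and "\<And>z. 0 < Re z \<Longrightarrow> has_bochner_integral M (\<lambda>\<omega>. exp (- z * of_real (Y \<omega>)))
      (exp (- of_real ((\<Sum>i\<in>I. rate i) * t)) *
        exp (\<Sum>i\<in>I. of_real (rate i / i) * (1 - exp (- z * of_real (t * i))) / z))"
proof -
  have mono: "mono_on {0..} (\<lambda>s. real (N i s \<omega>))" if "i \<in> I" "\<omega> \<in> space M" for i \<omega>
    using N that by (auto simp: poisson_process_def mono_on_def)
  have rv: "random_variable (count_space UNIV) (N i s)" if "i \<in> I" "0 \<le> s" for i s
    using N that by (auto simp: poisson_process_def)
  have int: "set_integrable lborel {0..t} (\<lambda>s. i * real (N i s \<omega>))"
    if "i \<in> I" "\<omega> \<in> space M" for i \<omega>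
    using that by (intro set_integrable_mult_right impI set_integrable_mono_on
        mono_on_subset[OF mono]) auto
  show Yint: "set_integrable lborel {0..t} (\<lambda>s. weighted_sum_process I N s \<omega>)"
    if "\<omega> \<in> space M" for \<omega>
    using int that I unfolding weighted_sum_process_def set_integrable_def scaleR_sum_right
    by (intro Bochner_Integration.integrable_sum) auto
  have Y: "Y \<omega> = (\<Sum>i\<in>I. i * (LINT s:{0..t}|lborel. real (N i s \<omega>)))"
    if "\<omega> \<in> space M" for \<omega>
  proof -
    have "Y \<omega> = (\<Sum>i\<in>I. LINT s:{0..t}|lborel. i * real (N i s \<omega>))"
      using int that unfolding Y_def weighted_sum_process_def set_integrable_def
        set_lebesgue_integral_def scaleR_sum_right
      by (intro Bochner_Integration.integral_sum) auto
    then show ?thesis by simp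
  qed
  define h where "h = (\<lambda>m. t / real (Suc m))"
  have h: "0 < h m" "real (Suc m) * h m = t" for m
    using t by (simp_all add: h_def)
  define S where "S = (\<lambda>m i \<omega>. h m * (\<Sum>k<Suc m. real (N i (real (Suc k) * h m) \<omega>)))"
  define R where "R = (\<lambda>m \<omega>. \<Sum>i\<in>I. i * S m i \<omega>)"
  have S_rv: "random_variable borel (S m i)" if "i \<in> I" for m i
  proof -
    have [measurable]: "random_variable (count_space UNIV) (N i (real (Suc k) * h m))" for k
      using that h(1)[of m] by (intro rv) (auto intro: mult_nonneg_nonneg)
    show ?thesis unfolding S_def by measurable
  qed
  have R_rv: "random_variable borel (R m)" for m
    unfolding R_def using S_rv by (intro borel_measurable_sum borel_measurable_times) auto
  have lim: "(\<lambda>m. R m \<omega>) \<longlonglongrightarrow> Y \<omega>" if "\<omega> \<in> space M" for \<omega>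
    unfolding R_def S_def Y[OF that] h_def
    using t by (intro tendsto_sum tendsto_mult tendsto_const riemann_sum_tendsto mono that) auto
  show Y_rv: "random_variable borel Y"
    using R_rv lim by (rule borel_measurable_LIMSEQ_real[rotated])
  \<comment> \<open>Independence of the processes carries over to any family of Borel functionals of
    their whole paths.\<close>
  have path: "indep_vars (\<lambda>_. borel) (\<lambda>i \<omega>. F i (\<lambda>s\<in>{0..}. N i s \<omega>)) I"
    if "\<And>i. i \<in> I \<Longrightarrow> F i \<in> borel_measurable (PiM {0..} (\<lambda>_. count_space UNIV))"
    for F :: "real \<Rightarrow> (real \<Rightarrow> nat) \<Rightarrow> 'c::topological_space"
    using indep unfolding indep_processes_def by (rule indep_vars_compose2) (use that in auto)
  show "has_bochner_integral M (\<lambda>\<omega>. exp (- z * of_real (Y \<omega>)))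
      (exp (- of_real ((\<Sum>i\<in>I. rate i) * t)) *
        exp (\<Sum>i\<in>I. of_real (rate i / i) * (1 - exp (- z * of_real (t * i))) / z))"
    if z: "0 < Re z" for z
  proof -
    \<comment> \<open>A dominating function that does not depend on \<open>m\<close>: each Riemann
      sum of \<open>N i\<close> lies between 0 and \<open>t\<close> times the value at time
      \<open>t\<close>, and \<open>\<bar>i\<bar>\<close> handles jumps of either sign. It is
      integrable as a product of independent factors with finite exponential moments.\<close>
    define V where "V = (\<lambda>\<omega>. \<Prod>i\<in>I. exp (Re z * \<bar>i\<bar> * t * of_nat (N i t \<omega>)))"
    have V_int: "integrable M V"
      unfolding V_def
    proof (rule indep_vars_integrable)
      show "indep_vars (\<lambda>_. borel) (\<lambda>i \<omega>. exp (Re z * \<bar>i\<bar> * t * real (N i t \<omega>))) I"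
        using path[of "\<lambda>i p. exp (Re z * \<bar>i\<bar> * t * real (p t))"] t by simp
      show "integrable M (\<lambda>\<omega>. exp (Re z * \<bar>i\<bar> * t * real (N i t \<omega>)))" if "i \<in> I" for i
      proof -
        \<comment> \<open>The value at time \<open>t\<close> is the increment from time 0, because
          paths start at 0.\<close>
        have "integrable M (\<lambda>\<omega>. exp (Re z * \<bar>i\<bar> * t * of_nat (N i t \<omega> - N i 0 \<omega>)))"
          using poisson_process_increment_exp[OF bspec[OF N that], of 0 t] t
          by (intro integrable.intros) auto
        then show ?thesis
          using N that by (subst Bochner_Integration.integrable_cong[OF refl]) (auto simp: poisson_process_def)
      qed
    qed (rule I)
    have bound: "norm (exp (- z * of_real (R m \<omega>))) \<le> V \<omega>" if "\<omega> \<in> space M" for m \<omega>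
    proof -
      have "\<bar>S m i \<omega>\<bar> \<le> t * real (N i t \<omega>)" if i: "i \<in> I" for i
      proof -
        have "(\<Sum>k<Suc m. real (N i (real (Suc k) * h m) \<omega>)) \<le> (\<Sum>k<Suc m. real (N i t \<omega>))"
        proof (intro sum_mono mono_onD[OF mono[OF i \<open>\<omega> \<in> space M\<close>]])
          fix k assume "k \<in> {..<Suc m}"
          then have "real (Suc k) * h m \<le> real (Suc m) * h m"
            using h(1)[of m] by (intro mult_right_mono) auto
          then show "real (Suc k) * h m \<le> t" using h(2) by simp
        qed (use h(1)[of m] t in auto)
        then have "S m i \<omega> \<le> h m * (real (Suc m) * real (N i t \<omega>))"
          unfolding S_def using h(1)[of m] by (intro mult_left_mono) auto
        also have "\<dots> = t * real (N i t \<omega>)"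
          using h(2)[of m] by (simp only: mult.assoc[symmetric] mult.commute[of "h m"])
        finally have "S m i \<omega> \<le> t * real (N i t \<omega>)" .
        moreover have "0 \<le> S m i \<omega>"
          unfolding S_def using h(1)[of m] by (intro mult_nonneg_nonneg sum_nonneg) auto
        ultimately show ?thesis by simp
      qed
      then have le: "- (i * S m i \<omega>) \<le> \<bar>i\<bar> * (t * real (N i t \<omega>))" if "i \<in> I" for i
        using that by (intro order_trans[OF abs_ge_minus_self]) (auto simp: abs_mult intro: mult_left_mono)
      have "- R m \<omega> = (\<Sum>i\<in>I. - (i * S m i \<omega>))"
        by (simp add: R_def sum_negf)
      also have "\<dots> \<le> (\<Sum>i\<in>I. \<bar>i\<bar> * (t * real (N i t \<omega>)))"
        using le by (intro sum_mono) blast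
      finally have "- R m \<omega> \<le> (\<Sum>i\<in>I. \<bar>i\<bar> * (t * real (N i t \<omega>)))" .
      then have "Re z * - R m \<omega> \<le> Re z * (\<Sum>i\<in>I. \<bar>i\<bar> * (t * real (N i t \<omega>)))"
        using z by (intro mult_left_mono) auto
      then show ?thesis
        by (simp add: V_def exp_sum[OF I(1), symmetric] sum_distrib_left mult.assoc)
    qed
    have R_exp: "has_bochner_integral M (\<lambda>\<omega>. exp (- z * of_real (R m \<omega>)))
        (\<Prod>i\<in>I. \<Prod>k<Suc m. exp (of_real (rate i * h m) *
          (exp (- z * of_real i * of_real (h m)) ^ Suc k - 1)))" for m
    proof -
      let ?X = "\<lambda>i \<omega>. exp (- z * of_real i * of_real (S m i \<omega>))"
      have X: "has_bochner_integral M (?X i)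
          (\<Prod>k<Suc m. exp (of_real (rate i * h m) *
            (exp (- z * of_real i * of_real (h m)) ^ Suc k - 1)))" if "i \<in> I" for i
        unfolding S_def using N that h by (intro poisson_process_riemann_sum_exp) auto
      have iv: "indep_vars (\<lambda>_. borel) ?X I"
      proof -
        \<comment> \<open>Only nonnegative times are coordinates of the product space, and the
          restricted path agrees with \<open>N i\<close> there.\<close>
        have nn: "0 \<le> real (Suc k) * h m" for k
          using h(1)[of m] by (intro mult_nonneg_nonneg) auto
        have [measurable]: "(\<lambda>p. p (real (Suc k) * h m)) \<in>
            measurable (PiM {0..} (\<lambda>_. count_space UNIV)) (count_space (UNIV :: nat set))" for k
          using nn by (intro measurable_component_singleton) auto
        have "(\<lambda>p. exp (- z * of_real i *
            of_real (h m * (\<Sum>k<Suc m. real (p (real (Suc k) * h m)))))) \<in>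
            borel_measurable (PiM {0..} (\<lambda>_. count_space (UNIV :: nat set)))" for i
          by measurable
        from path[OF this] show ?thesis
          using nn by (simp add: S_def del: of_nat_Suc sum.lessThan_Suc)
      qed
      have "integrable M (?X i)" if "i \<in> I" for i using X[OF that] by (rule integrable.intros)
      then have "has_bochner_integral M (\<lambda>\<omega>. \<Prod>i\<in>I. ?X i \<omega>) (\<Prod>i\<in>I. integral\<^sup>L M (?X i))"
        using I(1) iv
        by (simp only: has_bochner_integral_iff indep_vars_integrable indep_vars_lebesgue_integral)
      moreover have "(\<lambda>\<omega>. \<Prod>i\<in>I. ?X i \<omega>) = (\<lambda>\<omega>. exp (- z * of_real (R m \<omega>)))"
        by (simp add: R_def exp_sum[OF I(1), symmetric] sum_distrib_left sum_negf mult.assoc)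
      moreover have "(\<Prod>i\<in>I. integral\<^sup>L M (?X i)) =
          (\<Prod>i\<in>I. \<Prod>k<Suc m. exp (of_real (rate i * h m) *
            (exp (- z * of_real i * of_real (h m)) ^ Suc k - 1)))"
        using X by (intro prod.cong refl has_bochner_integral_integral_eq)
      ultimately show ?thesis by simp
    qed
    have Y_bm: "(\<lambda>\<omega>. exp (- z * of_real (Y \<omega>))) \<in> borel_measurable M"
      using Y_rv by measurable
    have R_bm: "(\<lambda>\<omega>. exp (- z * of_real (R m \<omega>))) \<in> borel_measurable M" for m
      using R_rv by measurable
    have ptw: "AE \<omega> in M. (\<lambda>m. exp (- z * of_real (R m \<omega>))) \<longlonglongrightarrow> exp (- z * of_real (Y \<omega>))"
      using lim by (intro AE_I2 tendsto_intros) auto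
    note dom = Y_bm R_bm V_int ptw AE_I2[OF bound]
    have "(\<lambda>m. \<integral>\<omega>. exp (- z * of_real (R m \<omega>)) \<partial>M) \<longlonglongrightarrow> (\<integral>\<omega>. exp (- z * of_real (Y \<omega>)) \<partial>M)"
      by (rule integral_dominated_convergence[OF dom])
    then have "(\<integral>\<omega>. exp (- z * of_real (Y \<omega>)) \<partial>M) =
        (\<Prod>i\<in>I. exp (of_real (rate i) * ((exp (- z * of_real i * of_real t) - 1) / (- z * of_real i) -
          of_real t)))"
    proof (rule LIMSEQ_unique)
      show "(\<lambda>m. \<integral>\<omega>. exp (- z * of_real (R m \<omega>)) \<partial>M) \<longlonglongrightarrow>
          (\<Prod>i\<in>I. exp (of_real (rate i) *
            ((exp (- z * of_real i * of_real t) - 1) / (- z * of_real i) - of_real t)))"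
        unfolding has_bochner_integral_integral_eq[OF R_exp] h_def
        using z I(2) t by (intro tendsto_prod exp_riemann_prod_tendsto) auto
    qed
    also have "(\<Prod>i\<in>I. exp (of_real (rate i) *
        ((exp (- z * of_real i * of_real t) - 1) / (- z * of_real i) - of_real t))) =
        exp (- of_real ((\<Sum>i\<in>I. rate i) * t)) *
        exp (\<Sum>i\<in>I. of_real (rate i / i) * (1 - exp (- z * of_real (t * i))) / z)"
    proof -
      \<comment> \<open>The signs in the quotient cancel, and the terms \<open>- rate i * t\<close>
        collect to the factor \<open>exp (- \<lambda> t)\<close>.\<close>
      have "of_real (rate i) * ((exp (- z * of_real i * of_real t) - 1) / (- z * of_real i) - of_real t) =
          of_real (rate i / i) * (1 - exp (- z * of_real (t * i))) / z - of_real (rate i * t)"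
        if "i \<in> I" for i
      proof -
        have "i \<noteq> 0" "z \<noteq> 0" using z that I(2) by auto
        then show ?thesis by (simp add: field_simps)
      qed
      then have "(\<Prod>i\<in>I. exp (of_real (rate i) *
          ((exp (- z * of_real i * of_real t) - 1) / (- z * of_real i) - of_real t))) =
          (\<Prod>i\<in>I. exp (of_real (rate i / i) * (1 - exp (- z * of_real (t * i))) / z - of_real (rate i * t)))"
        by (intro prod.cong refl arg_cong[where f = exp])
      also have "\<dots> = exp ((\<Sum>i\<in>I. of_real (rate i / i) * (1 - exp (- z * of_real (t * i))) / z) -
          of_real ((\<Sum>i\<in>I. rate i) * t))"
        by (simp only: exp_sum[OF I(1), symmetric] sum_subtractf of_real_sum[symmetric]
            sum_distrib_right[symmetric])
      finally show ?thesis
        by (simp only: exp_diff exp_minus divide_inverse mult.commute)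
    qed
    finally have "(\<integral>\<omega>. exp (- z * of_real (Y \<omega>)) \<partial>M) =
        exp (- of_real ((\<Sum>i\<in>I. rate i) * t)) *
        exp (\<Sum>i\<in>I. of_real (rate i / i) * (1 - exp (- z * of_real (t * i))) / z)"
      .
    moreover have "integrable M (\<lambda>\<omega>. exp (- z * of_real (Y \<omega>)))"
      by (rule integrable_dominated_convergence[OF dom])
    ultimately show ?thesis by (simp add: has_bochner_integral_iff)
  qed
qed

end

section \<open>Identification of the law on the positive half-line\<close>

theorem proposition4p3:
  fixes P :: "'a measure" and I :: "real set" and N :: "real \<Rightarrow> real \<Rightarrow> 'a \<Rightarrow> nat"
    and rate :: "real \<Rightarrow> real" and t :: real
  assumes "prob_space P"
    and "finite I" and "I \<noteq> {}" and "0 \<notin> I"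
    and "\<forall>i\<in>I. 0 < rate i"
    and "\<forall>i\<in>I. prob_space.poisson_process P (rate i) (N i)"
    and "prob_space.indep_processes P N I"
    and "0 < t"
  defines "Y \<equiv> \<lambda>\<omega>. LINT s:{0..t}|lborel. weighted_sum_process I N s \<omega>"
  shows "(\<forall>\<omega>\<in>space P. set_integrable lborel {0..t} (\<lambda>s. weighted_sum_process I N s \<omega>))
    \<and> Y \<in> borel_measurable P
    \<and> (\<forall>x>0. summable (\<lambda>n. density_term I rate t (Suc n) x))
    \<and> set_integrable lborel {0<..} (integral_density I rate t)
    \<and> (\<forall>A\<in>sets borel. A \<subseteq> {0<..} \<longrightarrow>
         measure P (Y -` A \<inter> space P) = (LINT x:A|lborel. integral_density I rate t x))"
proof -
  interpret P: prob_space P by fact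
  note laplace = P.laplace_weighted_integral[OF assms(2,4,6,7,8)]
  have Y_rv [measurable]: "Y \<in> borel_measurable P"
    unfolding Y_def by (rule laplace(2))
  have lap: "has_bochner_integral P (\<lambda>\<omega>. exp (- z * of_real (Y \<omega>)))
      (exp (- of_real ((\<Sum>i\<in>I. rate i) * t)) *
        exp (\<Sum>i\<in>I. of_real (rate i / i) * (1 - exp (- z * of_real (t * i))) / z))"
    if "0 < Re z" for z
    unfolding Y_def using that by (rule laplace(3))
  \<comment> \<open>\<open>?p\<close> is the weight of the point mass at 0: the constant by which
    the transform of the law exceeds that of the density.\<close>
  let ?\<mu> = "distr P borel Y" and ?p = "exp (- ((\<Sum>i\<in>I. rate i) * t))"
  have \<mu>: "real_distribution ?\<mu>" by simp
  \<comment> \<open>The transform at \<open>z = 1\<close> already contains the integrability of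
    \<open>exp (- Y)\<close>, which is not automatic since negative jumps can make \<open>Y\<close>
    negative.\<close>
  have "integrable P (\<lambda>\<omega>. exp (- Y \<omega>))"
    using integrable_norm[OF integrable.intros[OF lap[of 1]]] by simp
  then have e: "integrable ?\<mu> (\<lambda>x. exp (- x))"
    by (simp add: integrable_distr_eq)
  have L: "has_bochner_integral lborel
      (\<lambda>x. exp (- (1 + \<i> * of_real u) * of_real x) * of_real (integral_density I rate t x))
      ((LINT x|?\<mu>. exp (- (1 + \<i> * of_real u) * of_real x)) - of_real ?p)" for u
  proof -
    let ?z = "1 + \<i> * of_real u"
    have "(LINT x|?\<mu>. exp (- ?z * of_real x)) = (LINT \<omega>|P. exp (- ?z * of_real (Y \<omega>)))"
      by (rule integral_distr) auto
    also have "\<dots> = exp (- of_real ((\<Sum>i\<in>I. rate i) * t)) *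
        exp (\<Sum>i\<in>I. of_real (rate i / i) * (1 - exp (- ?z * of_real (t * i))) / ?z)"
      by (intro has_bochner_integral_integral_eq lap) simp
    finally have "(LINT x|?\<mu>. exp (- ?z * of_real x)) - of_real ?p =
        exp (- of_real ((\<Sum>i\<in>I. rate i) * t)) *
        (exp (\<Sum>i\<in>I. of_real (rate i / i) * (1 - exp (- ?z * of_real (t * i))) / ?z) - 1)"
      by (simp only: right_diff_distrib mult_1_right exp_of_real[symmetric] of_real_minus)
    then show ?thesis
      using laplace_integral_density[OF assms(2), where z = ?z and t = t and rate = rate] by simp
  qed
  note dens = density_on_pos_by_laplace[OF \<mu> e measurable_integral_density _ L]
  have "measure P (Y -` A \<inter> space P) = (LINT x:A|lborel. integral_density I rate t x)"
    if "A \<in> sets borel" "A \<subseteq> {0<..}" for A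
    using dens(2)[OF _ that] that by (simp add: measure_distr)
  then show ?thesis
    using laplace(1) Y_rv dens(1) summable_norm_cancel[OF summable_density_term[OF assms(2)]] by auto
qed

end
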